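(* Let $\mathfrak{h} = \mathfrak{n}_4$ be the nilpotent Lie algebra with basis $f_1,f_2,f_3,f_4$ and nonzero brackets $[f_1,f_2]=f_3$, $[f_1,f_3]=f_4$. Let $\mathfrak{g}$ be (isomorphic to) one of the following $4$-dimensional solvable Lie algebras, which are those non-nilpotent algebras in the paper's table whose nilshadow is $\mathbb{R}^4$: $\mathfrak{rr}_{3,\lambda}$ ($|\lambda| \le 1$), $\mathfrak{rr}'_{3,\lambda}$ ($\lambda \geq 0$), $\mathfrak{r}_2\mathfrak{r}_2$, $\mathfrak{r}'_2$, $\mathfrak{r}_{4,\mu,\lambda}$ ($\mu\lambda \neq 0$, and $-1<\mu\leq\lambda\leq 1$ or $-1=\mu\leq\lambda<0$), $\mathfrak{r}'_{4,\gamma,\delta}$ ($\gamma>0$, $\delta\in\mathbb{R}$). There exists a simply transitive action $\varphi: \mathfrak{g} \to \mathrm{aff}(\mathfrak{h})$ if and only if $\mathfrak{g}$ is isomorphic to $\mathfrak{r}_{4,\mu,\lambda}$ with $\mu=\lambda\in\{-1,\frac12,1\}$ or with $\mu=-\frac12$ and $\lambda=\frac12$.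
   Context: All Lie algebras and Lie groups are real and finite-dimensional; $1$-connected means connected and simply connected. For a $1$-connected nilpotent Lie group $H$ with Lie algebra $\mathfrak{h}$, $\mathrm{Aff}(H) = H \rtimes \mathrm{Aut}(H)$ acts on $H$ by $(h,\alpha)\cdot x = h\,\alpha(x)$, and its Lie algebra is $\mathrm{aff}(\mathfrak{h}) = \mathfrak{h}\rtimes\mathrm{Der}(\mathfrak{h})$. A simply transitive action $\varphi: \mathfrak{g}\to\mathrm{aff}(\mathfrak{h})$ is a Lie algebra morphism such that, for the $1$-connected Lie groups $G$, $H$ with Lie algebras $\mathfrak{g}$, $\mathfrak{h}$, the Lie group morphism $G \to \mathrm{Aff}(H)$ with differential $\varphi$ makes $G$ act simply transitively on $H$. The Lie algebras are given on a basis $e_1,e_2,e_3,e_4$ by the following nonzero brackets: $\mathfrak{rr}_{3,\lambda}$: $[e_1,e_2]=e_2$, $[e_1,e_3]=\lambda e_3$. $\mathfrak{rr}'_{3,\lambda}$: $[e_1,e_2]=\lambda e_2-e_3$, $[e_1,e_3]=e_2+\lambda e_3$. $\mathfrak{r}_2\mathfrak{r}_2$: $[e_1,e_2]=e_2$, $[e_3,e_4]=e_4$. $\mathfrak{r}'_2$: $[e_1,e_3]=e_3$, $[e_1,e_4]=e_4$, $[e_2,e_3]=e_4$, $[e_2,e_4]=-e_3$. $\mathfrak{r}_{4,\mu,\lambda}$: $[e_1,e_2]=e_2$, $[e_1,e_3]=\mu e_3$, $[e_1,e_4]=\lambda e_4$. $\mathfrak{r}'_{4,\gamma,\delta}$: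 $[e_1,e_2]=\gamma e_2$, $[e_1,e_3]=\delta e_3-e_4$, $[e_1,e_4]=e_3+\delta e_4$. The nilshadow of a solvable Lie algebra $\mathfrak{g}$ is the nilradical of its semisimple splitting; it is only used here to describe which algebras $\mathfrak{g}$ are considered, and these are listed explicitly. *)

theory Defs
  imports "HOL-Analysis.Analysis" "HOL-Algebra.Bij"
begin

section \<open>Lie algebras\<close>

text \<open>A finite-dimensional real Lie algebra is a bracket on a type of class
  \<open>euclidean_space\<close>; the inner product of the class plays no role.\<close>

definition lie_algebra :: "('g::real_vector \<Rightarrow> 'g \<Rightarrow> 'g) \<Rightarrow> bool" where
  "lie_algebra b \<longleftrightarrow> bilinear b \<and> (\<forall>x. b x x = 0) \<and>
     (\<forall>x y z. b x (b y z) + b y (b z x) + b z (b x y) = 0)"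

definition lie_iso ::
    "('g::real_vector \<Rightarrow> 'g \<Rightarrow> 'g) \<Rightarrow> ('h::real_vector \<Rightarrow> 'h \<Rightarrow> 'h) \<Rightarrow> ('g \<Rightarrow> 'h) \<Rightarrow> bool" where
  "lie_iso b c f \<longleftrightarrow> linear f \<and> bij f \<and> (\<forall>x y. f (b x y) = c (f x) (f y))"

definition lie_isomorphic ::
    "('g::real_vector \<Rightarrow> 'g \<Rightarrow> 'g) \<Rightarrow> ('h::real_vector \<Rightarrow> 'h \<Rightarrow> 'h) \<Rightarrow> bool" where
  "lie_isomorphic b c \<longleftrightarrow> (\<exists>f. lie_iso b c f)"

definition derivation ::
    "('h::euclidean_space \<Rightarrow> 'h \<Rightarrow> 'h) \<Rightarrow> ('h \<Rightarrow>\<^sub>L 'h) \<Rightarrow> bool" where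
  "derivation b D \<longleftrightarrow>
     (\<forall>x y. blinfun_apply D (b x y) = b (blinfun_apply D x) y + b x (blinfun_apply D y))"

text \<open>The bracket of \<open>aff(h) = h \<rtimes> Der(h)\<close>; the underlying space of \<open>aff(h)\<close> consists of
  the pairs in \<open>'h \<times> ('h \<Rightarrow>\<^sub>L 'h)\<close> whose second component is a derivation.\<close>

definition aff_bracket ::
    "('h::euclidean_space \<Rightarrow> 'h \<Rightarrow> 'h) \<Rightarrow>
     'h \<times> ('h \<Rightarrow>\<^sub>L 'h) \<Rightarrow> 'h \<times> ('h \<Rightarrow>\<^sub>L 'h) \<Rightarrow> 'h \<times> ('h \<Rightarrow>\<^sub>L 'h)" where
  "aff_bracket b = (\<lambda>(X, D) (Y, E).
     (b X Y + blinfun_apply D Y - blinfun_apply E X, (D o\<^sub>L E) - (E o\<^sub>L D)))"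

definition aff_morphism ::
    "('g::euclidean_space \<Rightarrow> 'g \<Rightarrow> 'g) \<Rightarrow> ('h::euclidean_space \<Rightarrow> 'h \<Rightarrow> 'h) \<Rightarrow>
     ('g \<Rightarrow> 'h \<times> ('h \<Rightarrow>\<^sub>L 'h)) \<Rightarrow> bool" where
  "aff_morphism g h \<phi> \<longleftrightarrow> linear \<phi> \<and> (\<forall>x. derivation h (snd (\<phi> x))) \<and>
     (\<forall>x y. \<phi> (g x y) = aff_bracket h (\<phi> x) (\<phi> y))"


section \<open>Smooth manifolds\<close>

text \<open>\<open>C\<^sup>k\<close> maps on an open subset of a finite-dimensional space.\<close>

primrec Ck_on ::
    "nat \<Rightarrow> ('a::real_normed_vector) set \<Rightarrow> ('a \<Rightarrow> 'b::real_normed_vector) \<Rightarrow> bool" where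
  "Ck_on 0 S f \<longleftrightarrow> continuous_on S f"
| "Ck_on (Suc k) S f \<longleftrightarrow> (\<forall>x\<in>S. f differentiable (at x)) \<and>
     (\<forall>v. Ck_on k S (\<lambda>x. frechet_derivative f (at x) v))"

definition smooth_on ::
    "('a::real_normed_vector) set \<Rightarrow> ('a \<Rightarrow> 'b::real_normed_vector) \<Rightarrow> bool" where
  "smooth_on S f \<longleftrightarrow> (\<forall>k. Ck_on k S f)"

text \<open>The atlas need not be maximal. A chart is a pair of its domain and its coordinate map.\<close>

record ('a, 'e) manifold =
  mtop :: "'a topology"
  atlas :: "('a set \<times> ('a \<Rightarrow> 'e)) set"

definition second_countable_space :: "'a topology \<Rightarrow> bool" where
  "second_countable_space T \<longleftrightarrow> (\<exists>B. countable B \<and> (\<forall>V\<in>B. openin T V) \<and>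
     (\<forall>U x. openin T U \<and> x \<in> U \<longrightarrow> (\<exists>V\<in>B. x \<in> V \<and> V \<subseteq> U)))"

definition smooth_manifold :: "('a, 'e::real_normed_vector) manifold \<Rightarrow> bool" where
  "smooth_manifold M \<longleftrightarrow>
     Hausdorff_space (mtop M) \<and> second_countable_space (mtop M) \<and>
     (\<Union>(U, \<psi>)\<in>atlas M. U) = topspace (mtop M) \<and>
     (\<forall>(U, \<psi>)\<in>atlas M. openin (mtop M) U \<and> open (\<psi> ` U) \<and>
        homeomorphic_map (subtopology (mtop M) U) (top_of_set (\<psi> ` U)) \<psi>) \<and>
     (\<forall>(U, \<psi>)\<in>atlas M. \<forall>(V, \<eta>)\<in>atlas M.
        smooth_on (\<psi> ` (U \<inter> V)) (\<lambda>p. \<eta> (inv_into U \<psi> p)))"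

definition smooth_map ::
    "('a, 'e::real_normed_vector) manifold \<Rightarrow> ('b, 'f::real_normed_vector) manifold \<Rightarrow>
     ('a \<Rightarrow> 'b) \<Rightarrow> bool" where
  "smooth_map M N f \<longleftrightarrow> continuous_map (mtop M) (mtop N) f \<and>
     (\<forall>(U, \<psi>)\<in>atlas M. \<forall>(V, \<eta>)\<in>atlas N.
        smooth_on (\<psi> ` {x\<in>U. f x \<in> V}) (\<lambda>p. \<eta> (f (inv_into U \<psi> p))))"

definition prod_manifold ::
    "('a, 'e) manifold \<Rightarrow> ('b, 'f) manifold \<Rightarrow> ('a \<times> 'b, 'e \<times> 'f) manifold" where
  "prod_manifold M N = \<lparr>mtop = prod_topology (mtop M) (mtop N),
     atlas = {(U \<times> V, map_prod \<psi> \<eta>) | U \<psi> V \<eta>. (U, \<psi>) \<in> atlas M \<and> (V, \<eta>) \<in> atlas N}\<rparr>"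

definition vec_manifold :: "('e::real_normed_vector, 'e) manifold" where
  "vec_manifold = \<lparr>mtop = euclidean, atlas = {(UNIV, id)}\<rparr>"

text \<open>Connected and simply connected (connectedness and path-connectedness agree for manifolds).\<close>

definition one_connected_space :: "'a topology \<Rightarrow> bool" where
  "one_connected_space T \<longleftrightarrow> path_connected_space T \<and>
     (\<forall>p. pathin T p \<and> p 1 = p 0 \<longrightarrow>
        homotopic_with (\<lambda>r. r 1 = r 0) (top_of_set {0..1}) T p (\<lambda>t. p 0))"


section \<open>Lie groups\<close>

record ('a, 'e) lie_group = "'a monoid" +
  mfd :: "('a, 'e) manifold"

definition lie_group :: "('a, 'e::real_normed_vector) lie_group \<Rightarrow> bool" where
  "lie_group G \<longleftrightarrow> Group.group G \<and> smooth_manifold (mfd G) \<and> topspace (mtop (mfd G)) = carrier G \<and>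
     smooth_map (prod_manifold (mfd G) (mfd G)) (mfd G) (\<lambda>(x, y). x \<otimes>\<^bsub>G\<^esub> y) \<and>
     smooth_map (mfd G) (mfd G) (\<lambda>x. inv\<^bsub>G\<^esub> x)"

text \<open>Given a chart \<open>(U, \<psi>)\<close> around the identity, the tangent space at the identity is the
  model space \<open>'e\<close>. The left-invariant vector field with value \<open>v\<close> at the identity is written in
  this chart, and \<open>tangent_bracket\<close> is the value at the identity of the Lie bracket
  \<open>[V, W] = DW V - DV W\<close> of two such fields.\<close>

definition left_invariant_field ::
    "('a, 'e::real_normed_vector) lie_group \<Rightarrow> 'a set \<times> ('a \<Rightarrow> 'e) \<Rightarrow> 'e \<Rightarrow> 'e \<Rightarrow> 'e" where
  "left_invariant_field G = (\<lambda>(U, \<psi>) v p.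
     frechet_derivative (\<lambda>q. \<psi> (inv_into U \<psi> p \<otimes>\<^bsub>G\<^esub> inv_into U \<psi> q)) (at (\<psi> \<one>\<^bsub>G\<^esub>)) v)"

definition tangent_bracket ::
    "('a, 'e::real_normed_vector) lie_group \<Rightarrow> 'a set \<times> ('a \<Rightarrow> 'e) \<Rightarrow> 'e \<Rightarrow> 'e \<Rightarrow> 'e" where
  "tangent_bracket G c v w =
     frechet_derivative (left_invariant_field G c w) (at (snd c \<one>\<^bsub>G\<^esub>)) v
     - frechet_derivative (left_invariant_field G c v) (at (snd c \<one>\<^bsub>G\<^esub>)) w"

text \<open>\<open>one_connected_lie_group_of G c \<theta> b\<close>: \<open>G\<close> is a 1-connected Lie group with Lie algebra \<open>b\<close>,
  where \<open>\<theta>\<close> identifies the Lie algebra with the tangent space at the identity in the chart \<open>c\<close>.\<close>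

definition one_connected_lie_group_of ::
    "('a, 'e::euclidean_space) lie_group \<Rightarrow> 'a set \<times> ('a \<Rightarrow> 'e) \<Rightarrow>
     ('g::euclidean_space \<Rightarrow> 'e) \<Rightarrow> ('g \<Rightarrow> 'g \<Rightarrow> 'g) \<Rightarrow> bool" where
  "one_connected_lie_group_of G c \<theta> b \<longleftrightarrow>
     lie_group G \<and> one_connected_space (mtop (mfd G)) \<and>
     c \<in> atlas (mfd G) \<and> \<one>\<^bsub>G\<^esub> \<in> fst c \<and> lie_iso b (tangent_bracket G c) \<theta>"


section \<open>The group of a nilpotent Lie algebra and its affine group\<close>

text \<open>For a nilpotent Lie algebra \<open>h\<close> of class at most 3, the 1-connected Lie group with Lie
  algebra \<open>h\<close> is \<open>h\<close> itself with the Baker-Campbell-Hausdorff product, which here stops at the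
  terms of order 3.\<close>

definition bch_group :: "('h::euclidean_space \<Rightarrow> 'h \<Rightarrow> 'h) \<Rightarrow> ('h, 'h) lie_group" where
  "bch_group b = \<lparr>carrier = UNIV,
     mult = (\<lambda>x y. x + y + (1/2) *\<^sub>R b x y + (1/12) *\<^sub>R (b x (b x y) + b y (b y x))),
     one = 0, mfd = vec_manifold\<rparr>"

definition lie_auto :: "('a, 'e::real_normed_vector) lie_group \<Rightarrow> ('a \<Rightarrow> 'a) set" where
  "lie_auto H = {\<alpha> \<in> auto H. smooth_map (mfd H) (mfd H) \<alpha> \<and>
     smooth_map (mfd H) (mfd H) (inv_into (carrier H) \<alpha>)}"

definition Aff :: "('a, 'e::real_normed_vector) lie_group \<Rightarrow> ('a \<times> ('a \<Rightarrow> 'a)) monoid" where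
  "Aff H = \<lparr>carrier = carrier H \<times> lie_auto H,
     mult = (\<lambda>(h, \<alpha>) (k, \<beta>). (h \<otimes>\<^bsub>H\<^esub> \<alpha> k, compose (carrier H) \<alpha> \<beta>)),
     one = (\<one>\<^bsub>H\<^esub>, \<lambda>x\<in>carrier H. x)\<rparr>"

definition aff_act :: "('a, 'e) lie_group \<Rightarrow> 'a \<times> ('a \<Rightarrow> 'a) \<Rightarrow> 'a \<Rightarrow> 'a" where
  "aff_act H = (\<lambda>(h, \<alpha>) x. h \<otimes>\<^bsub>H\<^esub> \<alpha> x)"

text \<open>For \<open>H = bch_group h\<close>, sending an automorphism of \<open>H\<close> to its differential at the identity
  \<open>0\<close> identifies \<open>Aut(H)\<close> with the closed subgroup \<open>Aut(h)\<close> of \<open>GL(h)\<close>, from which it gets its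
  Lie group structure. Thus \<open>aff_embed\<close> embeds \<open>Aff(H)\<close> as a submanifold of \<open>h \<times> End(h)\<close> whose
  tangent space at the identity is \<open>h \<times> Der(h)\<close>; smoothness of maps into \<open>Aff(H)\<close> and their
  differentials are taken there.\<close>

definition aff_embed :: "'h::euclidean_space \<times> ('h \<Rightarrow> 'h) \<Rightarrow> 'h \<times> ('h \<Rightarrow>\<^sub>L 'h)" where
  "aff_embed = (\<lambda>(h, \<alpha>). (h, Blinfun (frechet_derivative \<alpha> (at 0))))"

definition lie_morphism_to_Aff ::
    "('a, 'e::real_normed_vector) lie_group \<Rightarrow> ('h::euclidean_space, 'h) lie_group \<Rightarrow>
     ('a \<Rightarrow> 'h \<times> ('h \<Rightarrow> 'h)) \<Rightarrow> bool" where
  "lie_morphism_to_Aff G H \<rho> \<longleftrightarrow> \<rho> \<in> hom G (Aff H) \<and>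
     smooth_map (mfd G) vec_manifold (\<lambda>x. aff_embed (\<rho> x))"

definition aff_differential ::
    "('a, 'e::real_normed_vector) lie_group \<Rightarrow> 'a set \<times> ('a \<Rightarrow> 'e) \<Rightarrow>
     ('a \<Rightarrow> 'h::euclidean_space \<times> ('h \<Rightarrow> 'h)) \<Rightarrow> 'e \<Rightarrow> 'h \<times> ('h \<Rightarrow>\<^sub>L 'h)" where
  "aff_differential G = (\<lambda>(U, \<psi>) \<rho>.
     frechet_derivative (\<lambda>p. aff_embed (\<rho> (inv_into U \<psi> p))) (at (\<psi> \<one>\<^bsub>G\<^esub>)))"

text \<open>\<open>h\<close> is to be nilpotent of class at most 3. The group \<open>G\<close> and the morphism \<open>\<rho>\<close> are determined
  by \<open>g\<close> and \<open>\<phi>\<close> up to isomorphism. Taking the points of \<open>G\<close> in the type \<open>'g\<close> is no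
  restriction, since \<open>G\<close> has the cardinality of the continuum: only its set of points lies in
  \<open>'g\<close>, the topology and the atlas are arbitrary.\<close>

definition simply_transitive_action ::
    "('g::euclidean_space \<Rightarrow> 'g \<Rightarrow> 'g) \<Rightarrow> ('h::euclidean_space \<Rightarrow> 'h \<Rightarrow> 'h) \<Rightarrow>
     ('g \<Rightarrow> 'h \<times> ('h \<Rightarrow>\<^sub>L 'h)) \<Rightarrow> bool" where
  "simply_transitive_action g h \<phi> \<longleftrightarrow> aff_morphism g h \<phi> \<and>
     (\<exists>(G :: ('g, 'g) lie_group) c \<theta> \<rho>.
        one_connected_lie_group_of G c \<theta> g \<and>
        lie_morphism_to_Aff G (bch_group h) \<rho> \<and>
        (\<forall>X. aff_differential G c \<rho> (\<theta> X) = \<phi> X) \<and>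
        (\<forall>x\<in>carrier (bch_group h). \<forall>y\<in>carrier (bch_group h).
           \<exists>!a. a \<in> carrier G \<and> aff_act (bch_group h) (\<rho> a) x = y))"


section \<open>The Lie algebras of dimension 4\<close>

text \<open>A summand \<open>wedge i j x y *\<^sub>R v\<close> contributes the basis bracket
  \<open>[e\<^sub>i, e\<^sub>j] = v\<close>; the parameter usually called lambda is \<open>\<nu>\<close> here.\<close>

abbreviation ee :: "4 \<Rightarrow> real^4" where
  "ee i \<equiv> axis i 1"

definition wedge :: "4 \<Rightarrow> 4 \<Rightarrow> real^4 \<Rightarrow> real^4 \<Rightarrow> real" where
  "wedge i j x y = x $ i * y $ j - x $ j * y $ i"

definition n4 :: "real^4 \<Rightarrow> real^4 \<Rightarrow> real^4" where
  "n4 x y = wedge 1 2 x y *\<^sub>R ee 3 + wedge 1 3 x y *\<^sub>R ee 4"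

definition rr3 :: "real \<Rightarrow> real^4 \<Rightarrow> real^4 \<Rightarrow> real^4" where
  "rr3 \<nu> x y = wedge 1 2 x y *\<^sub>R ee 2 + wedge 1 3 x y *\<^sub>R (\<nu> *\<^sub>R ee 3)"

definition rr3' :: "real \<Rightarrow> real^4 \<Rightarrow> real^4 \<Rightarrow> real^4" where
  "rr3' \<nu> x y = wedge 1 2 x y *\<^sub>R (\<nu> *\<^sub>R ee 2 - ee 3) + wedge 1 3 x y *\<^sub>R (ee 2 + \<nu> *\<^sub>R ee 3)"

definition r2r2 :: "real^4 \<Rightarrow> real^4 \<Rightarrow> real^4" where
  "r2r2 x y = wedge 1 2 x y *\<^sub>R ee 2 + wedge 3 4 x y *\<^sub>R ee 4"

definition r2' :: "real^4 \<Rightarrow> real^4 \<Rightarrow> real^4" where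
  "r2' x y = wedge 1 3 x y *\<^sub>R ee 3 + wedge 1 4 x y *\<^sub>R ee 4 + wedge 2 3 x y *\<^sub>R ee 4 + wedge 2 4 x y *\<^sub>R (- ee 3)"

definition r4 :: "real \<Rightarrow> real \<Rightarrow> real^4 \<Rightarrow> real^4 \<Rightarrow> real^4" where
  "r4 \<mu> \<nu> x y = wedge 1 2 x y *\<^sub>R ee 2 + wedge 1 3 x y *\<^sub>R (\<mu> *\<^sub>R ee 3) + wedge 1 4 x y *\<^sub>R (\<nu> *\<^sub>R ee 4)"

definition r4' :: "real \<Rightarrow> real \<Rightarrow> real^4 \<Rightarrow> real^4 \<Rightarrow> real^4" where
  "r4' \<gamma> \<delta> x y = wedge 1 2 x y *\<^sub>R (\<gamma> *\<^sub>R ee 2) + wedge 1 3 x y *\<^sub>R (\<delta> *\<^sub>R ee 3 - ee 4)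
     + wedge 1 4 x y *\<^sub>R (ee 3 + \<delta> *\<^sub>R ee 4)"


lemma lie_algebra_families:
  "lie_algebra (rr3 \<nu>)" "lie_algebra (rr3' \<nu>)" "lie_algebra r2r2" "lie_algebra r2'"
  "lie_algebra (r4 \<mu> \<nu>)" "lie_algebra (r4' \<gamma> \<delta>)"
  unfolding lie_algebra_def bilinear_def rr3_def rr3'_def r2r2_def r2'_def r4_def r4'_def wedge_def
  by (auto intro!: linearI simp: vec_eq_iff forall_4 axis_def algebra_simps)

section \<open>The group of \<open>n4\<close>\<close>

lemma n4_nth [simp]:
  "n4 x y $ 1 = 0" "n4 x y $ 2 = 0"
  "n4 x y $ 3 = x $ 1 * y $ 2 - x $ 2 * y $ 1"
  "n4 x y $ 4 = x $ 1 * y $ 3 - x $ 3 * y $ 1"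
  by (simp_all add: n4_def wedge_def axis_def)

lemma lie_algebra_n4: "lie_algebra n4"
  unfolding lie_algebra_def bilinear_def
  by (auto intro!: linearI simp: vec_eq_iff forall_4 algebra_simps)

lemma bounded_bilinear_n4: "bounded_bilinear n4"
  using lie_algebra_n4 by (simp add: lie_algebra_def bilinear_conv_bounded_bilinear)

lemma n4_nilpotent: "n4 a (n4 b (n4 c d)) = 0"
  by (simp add: vec_eq_iff forall_4)

lemma Ck_on_cong:
  assumes "open S" "\<And>x. x \<in> S \<Longrightarrow> f x = g x" "Ck_on k S f"
  shows "Ck_on k S g"
  using assms(2,3)
proof (induction k arbitrary: f g)
  case 0
  then show ?case using continuous_on_cong[of S S f g] by simp
next
  case (Suc k)
  have der: "(g has_derivative frechet_derivative f (at x)) (at x)" if "x \<in> S" for x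
  proof (rule has_derivative_transform_within_open[OF _ assms(1) that])
    show "(f has_derivative frechet_derivative f (at x)) (at x)"
      using Suc.prems(2) that by (simp flip: frechet_derivative_works)
  qed (rule Suc.prems(1))
  then have "frechet_derivative f (at x) = frechet_derivative g (at x)" if "x \<in> S" for x
    using frechet_derivative_at that by blast
  moreover have "g differentiable (at x)" if "x \<in> S" for x
    using der[OF that] unfolding differentiable_def by blast
  ultimately show ?case
    using Suc.prems(2) Suc.IH[of "\<lambda>x. frechet_derivative f (at x) v" "\<lambda>x. frechet_derivative g (at x) v" for v]
    by simp
qed

lemma Ck_on_SucD: "Ck_on (Suc k) S f \<Longrightarrow> Ck_on k S f"
proof (induction k arbitrary: f)
  case 0
  then show ?case
    by (auto intro!: continuous_at_imp_continuous_on differentiable_imp_continuous_within)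
next
  case (Suc k)
  show ?case
    unfolding Ck_on.simps(2)[of k]
    using Suc.prems Suc.IH by (simp only: Ck_on.simps(2)[of "Suc k"]) blast
qed

lemma Ck_on_const: "Ck_on k S (\<lambda>x. c)"
  by (induction k arbitrary: c) auto

lemma Ck_on_linear: "bounded_linear f \<Longrightarrow> Ck_on k S f"
proof (induction k)
  case 0
  then show ?case by (simp add: linear_continuous_on)
next
  case (Suc k)
  have "frechet_derivative f (at x) = f" for x
    using Suc.prems bounded_linear_imp_has_derivative frechet_derivative_at by metis
  moreover have "f differentiable (at x)" for x
    using Suc.prems bounded_linear_imp_has_derivative differentiable_def by blast
  ultimately show ?case by (simp add: Ck_on_const)
qed

lemma Ck_on_add:
  assumes "open S" "Ck_on k S f" "Ck_on k S g"
  shows "Ck_on k S (\<lambda>x. f x + g x)"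
  using assms(2,3)
proof (induction k arbitrary: f g)
  case 0
  then show ?case by (simp add: continuous_on_add)
next
  case (Suc k)
  have "((\<lambda>x. f x + g x) has_derivative
      (\<lambda>v. frechet_derivative f (at x) v + frechet_derivative g (at x) v)) (at x)" if "x \<in> S" for x
    using Suc.prems that by (auto simp flip: frechet_derivative_works intro!: has_derivative_add)
  note d = this
  have "Ck_on k S (\<lambda>x. frechet_derivative (\<lambda>x. f x + g x) (at x) v)" for v
  proof (rule Ck_on_cong[OF assms(1)])
    show "Ck_on k S (\<lambda>x. frechet_derivative f (at x) v + frechet_derivative g (at x) v)"
      using Suc by auto
  qed (simp flip: frechet_derivative_at[OF d])
  moreover have "\<forall>x\<in>S. (\<lambda>x. f x + g x) differentiable (at x)"
    using d unfolding differentiable_def by blast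
  ultimately show ?case by simp
qed

lemma Ck_on_bilinear:
  assumes "open S" "bounded_bilinear B" "Ck_on k S f" "Ck_on k S g"
  shows "Ck_on k S (\<lambda>x. B (f x) (g x))"
  using assms(3,4)
proof (induction k arbitrary: f g)
  case 0
  then show ?case
    by (simp add: bounded_bilinear.continuous_on[OF assms(2)])
next
  case (Suc k)
  have "((\<lambda>x. B (f x) (g x)) has_derivative
      (\<lambda>v. B (f x) (frechet_derivative g (at x) v) + B (frechet_derivative f (at x) v) (g x))) (at x)"
    if "x \<in> S" for x
    using Suc.prems that
    by (auto simp flip: frechet_derivative_works intro!: bounded_bilinear.FDERIV[OF assms(2)])
  note d = this
  have "Ck_on k S (\<lambda>x. frechet_derivative (\<lambda>x. B (f x) (g x)) (at x) v)" for v
  proof (rule Ck_on_cong[OF assms(1)])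
    show "Ck_on k S (\<lambda>x. B (f x) (frechet_derivative g (at x) v) + B (frechet_derivative f (at x) v) (g x))"
      using Suc.prems(1,2)[THEN Ck_on_SucD] Suc.prems by (intro Ck_on_add assms(1) Suc.IH) auto
  qed (simp flip: frechet_derivative_at[OF d])
  moreover have "\<forall>x\<in>S. (\<lambda>x. B (f x) (g x)) differentiable (at x)"
    using d unfolding differentiable_def by blast
  ultimately show ?case by simp
qed

lemma Ck_on_scaleR:
  "open S \<Longrightarrow> Ck_on k S f \<Longrightarrow> Ck_on k S (\<lambda>x. c *\<^sub>R f x)"
  using Ck_on_bilinear[OF _ bounded_bilinear_scaleR Ck_on_const] .

lemma second_countable_euclidean:
  "second_countable_space (euclidean :: 'e::second_countable_topology topology)"
proof -
  obtain B :: "'e set set" where B: "countable B" "topological_basis B"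
    using ex_countable_basis by blast
  have "\<exists>V\<in>B. x \<in> V \<and> V \<subseteq> U" if "open U" "x \<in> U" for U x
    using topological_basisE[OF B(2) that] by metis
  then show ?thesis
    unfolding second_countable_space_def open_openin[symmetric]
    using B topological_basis_open by blast
qed

lemma smooth_manifold_vec: "smooth_manifold (vec_manifold :: ('e::euclidean_space, 'e) manifold)"
proof -
  have "smooth_on UNIV (\<lambda>p::'e. p)"
    unfolding smooth_on_def using Ck_on_linear[OF bounded_linear_ident] by blast
  moreover have "homeomorphic_map (euclidean :: 'e topology) euclidean (\<lambda>x. x)"
    using homeomorphic_map_id[of euclidean euclidean] by (simp add: id_def)
  ultimately show ?thesis
    by (simp add: smooth_manifold_def vec_manifold_def id_def second_countable_euclidean)
qed

lemma one_connected_vec: "one_connected_space (euclidean :: 'e::real_normed_vector topology)"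
  unfolding one_connected_space_def
proof (intro conjI allI impI)
  show "path_connected_space (euclidean :: 'e topology)"
    unfolding path_connected_space_def
  proof (intro ballI)
    fix x y :: 'e
    show "\<exists>g. pathin euclidean g \<and> g 0 = x \<and> g 1 = y"
      by (rule exI[of _ "linepath x y"])
        (simp add: pathin_def continuous_on_linepath, simp add: linepath_def)
  qed
next
  fix p :: "real \<Rightarrow> 'e" assume p: "pathin euclidean p \<and> p 1 = p 0"
  then have c: "continuous_on {0..1} p" by (simp add: pathin_def)
  have "continuous_on ({0..1} \<times> {0..1}) (\<lambda>(s, t). p t + s *\<^sub>R (p 0 - p t))"
    unfolding case_prod_beta
    by (intro continuous_intros continuous_on_compose2[OF c]) auto
  then show "homotopic_with (\<lambda>r. r 1 = r 0) (top_of_set {0..1}) euclidean p (\<lambda>t. p 0)"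
    unfolding homotopic_with_def
  proof (intro exI[of _ "\<lambda>(s, t). p t + s *\<^sub>R (p 0 - p t)"] conjI ballI)
    show "(\<lambda>r. r 1 = r 0) (\<lambda>t. (case (s, t) of (s, t) \<Rightarrow> p t + s *\<^sub>R (p 0 - p t)))" for s
      using p by simp
  qed simp_all
qed

lemma bch_n4_mult:
  "(x \<otimes>\<^bsub>bch_group n4\<^esub> y) $ 1 = x $ 1 + y $ 1"
  "(x \<otimes>\<^bsub>bch_group n4\<^esub> y) $ 2 = x $ 2 + y $ 2"
  "(x \<otimes>\<^bsub>bch_group n4\<^esub> y) $ 3 = x $ 3 + y $ 3 + (x $ 1 * y $ 2 - x $ 2 * y $ 1) / 2"
  "(x \<otimes>\<^bsub>bch_group n4\<^esub> y) $ 4 = x $ 4 + y $ 4 + (x $ 1 * y $ 3 - x $ 3 * y $ 1) / 2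
     + (x $ 1 - y $ 1) * (x $ 1 * y $ 2 - x $ 2 * y $ 1) / 12"
  by (simp_all add: bch_group_def algebra_simps diff_divide_distrib add_divide_distrib)

lemma bch_n4_group: "Group.group (bch_group n4)"
proof (rule groupI)
  fix x y z
  show "x \<otimes>\<^bsub>bch_group n4\<^esub> y \<otimes>\<^bsub>bch_group n4\<^esub> z = x \<otimes>\<^bsub>bch_group n4\<^esub> (y \<otimes>\<^bsub>bch_group n4\<^esub> z)"
    unfolding vec_eq_iff forall_4 bch_n4_mult
    by (intro conjI; simp add: algebra_simps diff_divide_distrib add_divide_distrib)
  show "\<exists>y\<in>carrier (bch_group n4). y \<otimes>\<^bsub>bch_group n4\<^esub> x = \<one>\<^bsub>bch_group n4\<^esub>"
    by (rule bexI[of _ "- x"], unfold vec_eq_iff forall_4 bch_n4_mult) (simp_all add: bch_group_def)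
qed (simp_all add: bch_group_def vec_eq_iff forall_4)

lemma bch_n4_inv: "inv\<^bsub>bch_group n4\<^esub> x = - x"
proof (rule group.inv_equality[OF bch_n4_group])
  show "- x \<otimes>\<^bsub>bch_group n4\<^esub> x = \<one>\<^bsub>bch_group n4\<^esub>"
    unfolding vec_eq_iff forall_4 bch_n4_mult by (simp add: bch_group_def)
qed (simp_all add: bch_group_def)

lemma bch_n4_lie_group: "lie_group (bch_group n4)"
proof -
  let ?m = "\<lambda>p. fst p + snd p + (1/2) *\<^sub>R n4 (fst p) (snd p)
      + (1/12) *\<^sub>R (n4 (fst p) (n4 (fst p) (snd p)) + n4 (snd p) (n4 (snd p) (fst p)))"
  have "Ck_on k UNIV ?m" for k
  proof -
    note f = Ck_on_linear[OF bounded_linear_fst, of k UNIV]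
    note s = Ck_on_linear[OF bounded_linear_snd, of k UNIV]
    note add = Ck_on_add[OF open_UNIV] and scale = Ck_on_scaleR[OF open_UNIV]
    note b = Ck_on_bilinear[OF open_UNIV bounded_bilinear_n4]
    show ?thesis
      by (rule add[OF add[OF add[OF f s] scale[OF b[OF f s]]]
            scale[OF add[OF b[OF f b[OF f s]] b[OF s b[OF s f]]]]])
  qed
  note Ck = this
  then have m: "smooth_on UNIV ?m" by (simp add: smooth_on_def)
  have "continuous_on UNIV ?m" using Ck[of 0] by (simp only: Ck_on.simps)
  with m have "smooth_map (prod_manifold vec_manifold vec_manifold) vec_manifold
      (\<lambda>(x, y). x \<otimes>\<^bsub>bch_group n4\<^esub> y)"
    by (simp add: smooth_map_def prod_manifold_def vec_manifold_def bch_group_def case_prod_beta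
        map_prod.id)
  moreover have "smooth_map vec_manifold vec_manifold (\<lambda>x::real^4. - x)"
    using Ck_on_linear[OF bounded_linear_minus[OF bounded_linear_ident], where S = UNIV]
    by (auto simp: smooth_map_def vec_manifold_def smooth_on_def continuous_on_minus)
  ultimately show ?thesis
    using smooth_manifold_vec bch_n4_group
    by (simp add: lie_group_def bch_n4_inv) (simp add: bch_group_def vec_manifold_def)
qed

text \<open>The group \<open>bch_group n4\<close> is the 1-connected Lie group with Lie algebra \<open>n4\<close>, the tangent
  space at \<open>0\<close> being \<open>n4\<close> itself.\<close>

theorem bch_n4_one_connected_lie_group:
  "one_connected_lie_group_of (bch_group n4) (UNIV, id) id n4"
proof -
  interpret n4: bounded_bilinear n4 by (rule bounded_bilinear_n4)
  define L where "L v p = v + (1/2) *\<^sub>R n4 p v + (1/12) *\<^sub>R n4 p (n4 p v)" for v p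
  have d: "((\<lambda>q. p + q + (1/2) *\<^sub>R n4 p q + (1/12) *\<^sub>R (n4 p (n4 p q) + n4 q (n4 q p)))
      has_derivative (\<lambda>v. L v p)) (at 0)" for p
    unfolding L_def
    by (rule has_derivative_eq_rhs, rule has_derivative_add[OF has_derivative_add[OF
          has_derivative_add[OF has_derivative_const has_derivative_ident]
          has_derivative_scaleR_right[OF n4.FDERIV[OF has_derivative_const has_derivative_ident]]]
          has_derivative_scaleR_right[OF has_derivative_add[OF
            n4.FDERIV[OF has_derivative_const n4.FDERIV[OF has_derivative_const has_derivative_ident]]
            n4.FDERIV[OF has_derivative_ident n4.FDERIV[OF has_derivative_ident has_derivative_const]]]]])
      (simp add: fun_eq_iff n4.zero_left n4.zero_right)
  have L: "left_invariant_field (bch_group n4) (UNIV, id) v p = L v p" for v p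
    by (simp add: left_invariant_field_def bch_group_def flip: frechet_derivative_at[OF d])
  have "(L v has_derivative (\<lambda>u. (1/2) *\<^sub>R n4 u v)) (at 0)" for v
    unfolding L_def
    by (rule has_derivative_eq_rhs, rule has_derivative_add[OF
          has_derivative_add[OF has_derivative_const
            has_derivative_scaleR_right[OF n4.FDERIV[OF has_derivative_ident has_derivative_const]]]
          has_derivative_scaleR_right[OF
            n4.FDERIV[OF has_derivative_ident n4.FDERIV[OF has_derivative_ident has_derivative_const]]]])
      (simp add: fun_eq_iff n4.zero_left n4.zero_right)
  then have "frechet_derivative (L v) (at 0) = (\<lambda>u. (1/2) *\<^sub>R n4 u v)" for v
    by (rule frechet_derivative_at[symmetric])
  moreover have "left_invariant_field (bch_group n4) (UNIV, id) v = L v" for v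
    using L by blast
  ultimately have "tangent_bracket (bch_group n4) (UNIV, id) v w = n4 v w" for v w
    by (simp add: tangent_bracket_def)
      (simp add: bch_group_def vec_eq_iff forall_4 algebra_simps)
  then show ?thesis
    using bch_n4_lie_group one_connected_vec
    by (simp add: one_connected_lie_group_of_def lie_iso_def linear_iff)
      (simp add: bch_group_def vec_manifold_def)
qed

end

theory Submission
  imports Defs
begin

text \<open>
  Let \<open>\<phi>\<close> be simply transitive. By Sard's theorem the vector fields \<open>\<phi> X\<close>, \<open>X \<noteq> 0\<close>, have no
  zeros on the group of \<open>n4\<close>. Derivations of \<open>n4\<close> are triangular, with eigenvalues
  \<open>a, e, a + e, 2 a + e\<close>. So no \<open>ad X\<close> has a non-real eigenvalue, which excludes \<open>rr3'\<close> and
  \<open>r4'\<close>. If \<open>ad X\<close> is diagonalizable, then conjugation by an automorphism and a translation brings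
  \<open>\<phi> X\<close> to a form from which one reads off that the eigenvalues of \<open>ad X\<close> are
  \<open>a, e, a + e, 2 a + e\<close> for some \<open>a, e\<close>. Such a list has at most one zero
  or only zeros, which excludes \<open>rr3\<close>, \<open>r2r2\<close> and \<open>r2'\<close>, and comparison with
  \<open>0, 1, \<mu>, \<nu>\<close> leaves the four stated cases of \<open>r4\<close>. Conversely, in these cases the
  diagonal derivation together with a unipotent correction gives an explicit simply transitive action.
\<close>

text \<open>A zero of \<open>\<phi> X\<close> would be fixed by a one-parameter subgroup of
  \<open>G\<close>. Since \<open>G\<close> comes with an arbitrary atlas, producing this subgroup
  would mean integrating a vector field; Sard's theorem replaces that. At the point \<open>0\<close>
  the field is just the translation part of \<open>\<phi> X\<close>, so after transport of the Lie
  algebra to \<open>real^4\<close> the translation part is a linear bijection.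

  Diagonalizability of \<open>ad X\<close> need not make \<open>\<phi> X\<close> semisimple, because
  the image of \<open>\<phi>\<close> is only a part of the affine algebra. Conjugation therefore
  aims only at making the nilpotent remainder commute with the diagonal part; an eigenvector of
  \<open>ad X\<close> can then have a nonzero translation coordinate only where the weight equals
  its eigenvalue.

  Any two of the forms \<open>a, e, a + e, 2 a + e\<close> are linearly independent, which is why
  two zeros force all four to vanish. For \<open>r4\<close> exactly one form vanishes. Each of the
  four choices leaves one list up to scale, and the eigenvalue 1 together with the parameter range
  fixes the scale.\<close>

section \<open>Closure properties of C^k maps\<close>

lemma Ck_on_sum:
  assumes "open S" "\<And>i. i \<in> I \<Longrightarrow> Ck_on k S (f i)"
  shows "Ck_on k S (\<lambda>x. \<Sum>i\<in>I. f i x)"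
  using assms(2)
  by (induction I rule: infinite_finite_induct) (simp_all add: Ck_on_const Ck_on_add assms(1))

text \<open>Each directional derivative is a constant multiple of the function itself, so the
  induction on \<open>k\<close> closes without any generalization.\<close>

lemma Ck_on_exp_linear:
  fixes l :: "'a::real_normed_vector \<Rightarrow> real"
  assumes "open S" "bounded_linear l"
  shows "Ck_on k S (\<lambda>x. exp (l x))"
proof (induction k)
  case 0
  show ?case
    by (simp add: continuous_on_exp linear_continuous_on assms(2))
next
  case (Suc k)
  have d: "((\<lambda>x. exp (l x)) has_derivative (\<lambda>v. l v *\<^sub>R exp (l x))) (at x)" for x
    by (auto intro!: derivative_eq_intros bounded_linear_imp_has_derivative[OF assms(2)])
  have "(\<lambda>x. frechet_derivative (\<lambda>x. exp (l x)) (at x) v) = (\<lambda>x. l v *\<^sub>R exp (l x))" for v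
    by (simp add: fun_eq_iff flip: frechet_derivative_at[OF d])
  moreover have "(\<lambda>x. exp (l x)) differentiable (at x)" for x
    using d unfolding differentiable_def by blast
  ultimately show ?case
    using Ck_on_scaleR[OF assms(1) Suc] by simp
qed

lemma Ck_on_bounded_linear_compose:
  assumes "open S" "bounded_linear L" "Ck_on k S f"
  shows "Ck_on k S (\<lambda>x. L (f x))"
  using assms(3)
proof (induction k arbitrary: f)
  case 0
  then show ?case
    by (simp add: bounded_linear.continuous_on[OF assms(2)])
next
  case (Suc k)
  have d: "((\<lambda>x. L (f x)) has_derivative (\<lambda>v. L (frechet_derivative f (at x) v))) (at x)"
    if "x \<in> S" for x
    using Suc.prems that
    by (auto simp flip: frechet_derivative_works intro!: bounded_linear.has_derivative[OF assms(2)])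
  have "Ck_on k S (\<lambda>x. frechet_derivative (\<lambda>x. L (f x)) (at x) v)" for v
  proof (rule Ck_on_cong[OF assms(1)])
    show "Ck_on k S (\<lambda>x. L (frechet_derivative f (at x) v))"
      using Suc by auto
  qed (simp flip: frechet_derivative_at[OF d])
  moreover have "\<forall>x\<in>S. (\<lambda>x. L (f x)) differentiable (at x)"
    using d unfolding differentiable_def by blast
  ultimately show ?case by simp
qed

lemma Ck_on_axis:
  fixes f :: "'a::real_normed_vector \<Rightarrow> real^'n"
  assumes "open S" "\<And>j. Ck_on k S (\<lambda>x. f x $ j)"
  shows "Ck_on k S f"
proof -
  have "Ck_on k S (\<lambda>x. \<Sum>j\<in>UNIV. f x $ j *\<^sub>R (axis j 1 :: real^'n))"
    by (intro Ck_on_sum assms(1) Ck_on_bilinear[OF assms(1) bounded_bilinear_scaleR] assms(2) Ck_on_const)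
  moreover have "(\<lambda>x. \<Sum>j\<in>UNIV. f x $ j *\<^sub>R axis j 1) = f"
    by (simp add: fun_eq_iff basis_expansion flip: scalar_mult_eq_scaleR)
  ultimately show ?thesis by (simp only:)
qed

lemma smooth_map_vecI:
  assumes "\<And>k. Ck_on k UNIV f"
  shows "smooth_map vec_manifold vec_manifold f"
proof -
  have "continuous_on UNIV f" using assms[of 0] by simp
  then show ?thesis using assms by (simp add: smooth_map_def vec_manifold_def smooth_on_def id_def)
qed

section \<open>Simply transitive models\<close>

text \<open>The group is \<open>\<real> \<ltimes> \<real>\<^sup>3\<close>, where the \<open>i\<close>-th coordinate acts through the one-parameter group of
  dilations with weights \<open>w\<close>. The conditions on \<open>w\<close> say that the dilations are automorphisms
  of \<open>n4\<close>.\<close>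

locale affine_model =
  fixes F :: "'g::euclidean_space \<Rightarrow> real^4" and w :: "real^4" and i :: 4
  assumes linear_F: "linear F" and bij_F: "bij F"
    and w_i: "w $ i = 0" and w_3: "w $ 3 = w $ 1 + w $ 2" and w_4: "w $ 4 = 2 * w $ 1 + w $ 2"
begin

abbreviation F' :: "real^4 \<Rightarrow> 'g" where "F' \<equiv> inv_into UNIV F"

definition dil :: "real \<Rightarrow> real^4 \<Rightarrow> real^4" where
  "dil r z = (\<chi> j. exp (r * w $ j) * z $ j)"

text \<open>The points must lie in \<open>'g\<close>, so the semidirect product on
  \<open>real^4\<close> is pulled back along \<open>F\<close>. As \<open>w $ i = 0\<close>, the
  \<open>i\<close>-th coordinate is additive and serves as the acting factor.\<close>

definition G :: "('g, 'g) lie_group" where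
  "G = \<lparr>carrier = UNIV, mult = (\<lambda>x y. x + F' (dil (F x $ i) (F y))), one = 0, mfd = vec_manifold\<rparr>"

text \<open>In the coordinates \<open>F\<close>, \<open>ad\<close> of the \<open>i\<close>-th basis
  vector is diagonal with entries \<open>w\<close>, and the other basis vectors commute with each
  other.\<close>

definition bracket :: "'g \<Rightarrow> 'g \<Rightarrow> 'g" where
  "bracket x y = F' (\<chi> j. w $ j * (F x $ i * F y $ j - F x $ j * F y $ i))"

lemma F_F' [simp]: "F (F' z) = z" and F'_F [simp]: "F' (F x) = x"
  using bij_F by (simp_all add: bij_is_surj surj_f_inv_f bij_is_inj inv_f_f)

lemma F_eqI: "F x = F y \<Longrightarrow> x = y"
  using bij_F by (simp add: bij_is_inj inj_eq)

lemma linear_F': "linear F'"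
  by (rule linearI; rule F_eqI)
    (simp_all add: linear_add[OF linear_F] linear_scale[OF linear_F])

lemma bl_F: "bounded_linear F" and bl_F': "bounded_linear F'"
  using linear_F linear_F' by (simp_all add: linear_conv_bounded_linear)

lemma bl_F_nth: "bounded_linear (\<lambda>x. F x $ j)"
  using bounded_linear_compose[OF bounded_linear_vec_nth bl_F] .

lemma dil_nth [simp]: "dil r z $ j = exp (r * w $ j) * z $ j"
  by (simp add: dil_def)

lemma linear_dil: "linear (dil r)"
  by (rule linearI) (simp_all add: vec_eq_iff algebra_simps)

lemma F_mult: "F (x \<otimes>\<^bsub>G\<^esub> y) = F x + dil (F x $ i) (F y)"
  by (simp add: G_def linear_add[OF linear_F])

lemma group_G: "Group.group G"
proof (rule groupI)
  fix x y z
  show "x \<otimes>\<^bsub>G\<^esub> y \<otimes>\<^bsub>G\<^esub> z = x \<otimes>\<^bsub>G\<^esub> (y \<otimes>\<^bsub>G\<^esub> z)"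
    by (rule F_eqI) (simp add: F_mult vec_eq_iff w_i algebra_simps exp_add)
  show "\<exists>y\<in>carrier G. y \<otimes>\<^bsub>G\<^esub> x = \<one>\<^bsub>G\<^esub>"
  proof (rule bexI)
    show "F' (- dil (- F x $ i) (F x)) \<otimes>\<^bsub>G\<^esub> x = \<one>\<^bsub>G\<^esub>"
      by (rule F_eqI) (simp add: F_mult vec_eq_iff w_i, simp add: G_def linear_0[OF linear_F])
  qed (simp add: G_def)
  show "\<one>\<^bsub>G\<^esub> \<otimes>\<^bsub>G\<^esub> x = x"
    by (rule F_eqI) (simp add: F_mult vec_eq_iff, simp add: G_def linear_0[OF linear_F])
qed (simp_all add: G_def)

lemma inv_G: "inv\<^bsub>G\<^esub> x = F' (- dil (- F x $ i) (F x))"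
proof (rule group.inv_equality[OF group_G])
  show "F' (- dil (- F x $ i) (F x)) \<otimes>\<^bsub>G\<^esub> x = \<one>\<^bsub>G\<^esub>"
    by (rule F_eqI) (simp add: F_mult vec_eq_iff w_i, simp add: G_def linear_0[OF linear_F])
qed (simp_all add: G_def)

lemma lie_group_G: "lie_group G"
proof -
  note bilin = Ck_on_bilinear[OF open_UNIV bounded_bilinear_mult]
  have m: "Ck_on k UNIV (\<lambda>p. fst p + F' (dil (F (fst p) $ i) (F (snd p))))" for k
  proof (intro Ck_on_add open_UNIV Ck_on_linear[OF bounded_linear_fst]
      Ck_on_bounded_linear_compose[OF _ bl_F'] Ck_on_axis)
    fix j
    have "Ck_on k UNIV (\<lambda>p::'g \<times> 'g. exp (F (fst p) $ i * w $ j) * (F (snd p) $ j))"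
      by (intro bilin Ck_on_exp_linear open_UNIV Ck_on_linear
          bounded_linear_compose[OF bounded_linear_mult_left bounded_linear_compose[OF bl_F_nth bounded_linear_fst]]
          bounded_linear_compose[OF bl_F_nth bounded_linear_snd])
    then show "Ck_on k UNIV (\<lambda>p::'g \<times> 'g. dil (F (fst p) $ i) (F (snd p)) $ j)"
      by simp
  qed
  have n: "Ck_on k UNIV (\<lambda>x. F' (- dil (- F x $ i) (F x)))" for k
  proof (intro open_UNIV Ck_on_bounded_linear_compose[OF _ bl_F'] Ck_on_axis)
    fix j
    have "Ck_on k UNIV (\<lambda>x. exp (F x $ i * (- w $ j)) * (- F x $ j))"
      by (intro bilin Ck_on_exp_linear open_UNIV Ck_on_linear bounded_linear_minus bl_F_nth
          bounded_linear_compose[OF bounded_linear_mult_left bl_F_nth])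
    then show "Ck_on k UNIV (\<lambda>x. (- dil (- F x $ i) (F x)) $ j)"
      by simp
  qed
  have "continuous_on UNIV (\<lambda>p. fst p + F' (dil (F (fst p) $ i) (F (snd p))))"
    using m[of 0] by (simp only: Ck_on.simps)
  with m have "smooth_map (prod_manifold vec_manifold vec_manifold) vec_manifold
      (\<lambda>(x, y). x \<otimes>\<^bsub>G\<^esub> y)"
    by (simp add: smooth_map_def prod_manifold_def vec_manifold_def G_def case_prod_beta
        map_prod.id smooth_on_def)
  moreover have "smooth_map vec_manifold vec_manifold (\<lambda>x. F' (- dil (- F x $ i) (F x)))"
    by (rule smooth_map_vecI) (rule n)
  ultimately show ?thesis
    using smooth_manifold_vec group_G
    by (simp add: lie_group_def inv_G) (simp add: G_def vec_manifold_def)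
qed

text \<open>In the coordinates \<open>F\<close>, left translation by \<open>p\<close> is affine with
  linear part \<open>dil (F p $ i)\<close>. A left-invariant field depends on \<open>p\<close> only
  through this dilation, whose derivative at \<open>0\<close> in direction \<open>u\<close> has the
  entries \<open>F u $ i * w $ j\<close>; antisymmetrizing gives the bracket.\<close>

lemma tangent_bracket_G: "tangent_bracket G (UNIV, id) u v = bracket u v"
proof -
  have d: "((\<lambda>q. p + F' (dil (F p $ i) (F q))) has_derivative (\<lambda>v. F' (dil (F p $ i) (F v)))) (at 0)"
    for p
  proof -
    have "bounded_linear (\<lambda>q. F' (dil (F p $ i) (F q)))"
      using bounded_linear_compose[OF bl_F' bounded_linear_compose[OF _ bl_F]] linear_dil
      by (simp add: linear_conv_bounded_linear)
    then have "((\<lambda>q. p + F' (dil (F p $ i) (F q))) has_derivative (\<lambda>v. 0 + F' (dil (F p $ i) (F v)))) (at 0)"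
      by (intro has_derivative_add has_derivative_const bounded_linear_imp_has_derivative)
    then show ?thesis by simp
  qed
  have L: "left_invariant_field G (UNIV, id) v = (\<lambda>p. F' (dil (F p $ i) (F v)))" for v
    by (simp add: left_invariant_field_def G_def fun_eq_iff flip: frechet_derivative_at[OF d])
  have "((\<lambda>p. dil (F p $ i) (F v)) has_derivative (\<lambda>u. \<chi> j. F u $ i * w $ j * F v $ j)) (at 0)" for v
  proof (subst has_derivative_componentwise_within, intro ballI)
    fix b :: "real^4" assume "b \<in> Basis"
    then obtain j where b: "b = axis j 1" by (auto simp: Basis_vec_def)
    have "((\<lambda>x. exp (F x $ i * w $ j) * F v $ j) has_derivative (\<lambda>u. F u $ i * w $ j * F v $ j)) (at 0)"
      by (auto intro!: derivative_eq_intros bounded_linear_imp_has_derivative[OF bl_F_nth]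
          simp: linear_0[OF linear_F])
    then show "((\<lambda>x. dil (F x $ i) (F v) \<bullet> b) has_derivative (\<lambda>x. (\<chi> j. F x $ i * w $ j * F v $ j) \<bullet> b)) (at 0)"
      by (simp add: b inner_axis)
  qed
  from bounded_linear.has_derivative[OF bl_F' this]
  have "frechet_derivative (left_invariant_field G (UNIV, id) v) (at 0) =
      (\<lambda>u. F' (\<chi> j. F u $ i * w $ j * F v $ j))" for v
    unfolding L by (rule frechet_derivative_at[symmetric])
  then have "tangent_bracket G (UNIV, id) u v =
     F' (\<chi> j. F u $ i * w $ j * F v $ j) - F' (\<chi> j. F v $ i * w $ j * F u $ j)"
    by (simp add: tangent_bracket_def) (simp add: G_def)
  also have "\<dots> = F' ((\<chi> j. F u $ i * w $ j * F v $ j) - (\<chi> j. F v $ i * w $ j * F u $ j))"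
    by (rule linear_diff[OF linear_F', symmetric])
  also have "\<dots> = bracket u v"
    unfolding bracket_def by (rule arg_cong[of _ _ F']) (simp add: vec_eq_iff algebra_simps)
  finally show ?thesis .
qed

lemma one_connected_G: "one_connected_lie_group_of G (UNIV, id) id bracket"
  using lie_group_G one_connected_vec
  by (simp add: one_connected_lie_group_of_def lie_iso_def linear_iff tangent_bracket_G)
    (simp add: G_def vec_manifold_def)

end

section \<open>Linear maps as bounded operators and as automorphisms\<close>

lemma blinfun_apply_Blinfun:
  "linear f \<Longrightarrow> blinfun_apply (Blinfun f) = (f :: 'a::euclidean_space \<Rightarrow> 'b::real_normed_vector)"
  by (simp add: bounded_linear_Blinfun_apply linear_conv_bounded_linear)

text \<open>For a family of linear maps this exhibits the operator as a sum of scalar entries times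
  fixed matrix units, so smoothness of the entries passes to the operator-valued map.\<close>

lemma Blinfun_matrix_expansion:
  fixes f :: "real^'n \<Rightarrow> real^'m"
  assumes "linear f"
  shows "Blinfun f =
    (\<Sum>a\<in>UNIV. \<Sum>b\<in>UNIV. (f (axis b 1) $ a) *\<^sub>R Blinfun (\<lambda>z. (z $ b) *\<^sub>R axis a 1))"
proof (rule blinfun_eqI)
  fix z
  have u: "linear (\<lambda>z::real^'n. (z $ b) *\<^sub>R (axis a 1 :: real^'m))" for a b
    by (rule linearI) (simp_all add: algebra_simps)
  have "f z = (\<Sum>b\<in>UNIV. (z $ b) *\<^sub>R f (axis b 1))"
    using linear_sum[OF assms, of "\<lambda>b. (z $ b) *\<^sub>R axis b 1" UNIV] linear_scale[OF assms]
      basis_expansion[of z] by (simp add: scalar_mult_eq_scaleR)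
  also have "\<dots> = (\<Sum>b\<in>UNIV. \<Sum>a\<in>UNIV. (f (axis b 1) $ a) *\<^sub>R (z $ b) *\<^sub>R axis a 1)"
  proof (rule sum.cong[OF refl])
    fix b
    have "(z $ b) *\<^sub>R f (axis b 1) = (z $ b) *\<^sub>R (\<Sum>a\<in>UNIV. (f (axis b 1) $ a) *\<^sub>R axis a 1)"
      by (simp add: basis_expansion flip: scalar_mult_eq_scaleR)
    then show "(z $ b) *\<^sub>R f (axis b 1) = (\<Sum>a\<in>UNIV. (f (axis b 1) $ a) *\<^sub>R (z $ b) *\<^sub>R axis a 1)"
      by (simp add: scaleR_sum_right mult.commute)
  qed
  also have "\<dots> = (\<Sum>a\<in>UNIV. \<Sum>b\<in>UNIV. (f (axis b 1) $ a) *\<^sub>R (z $ b) *\<^sub>R axis a 1)"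
    by (rule sum.swap)
  finally show "blinfun_apply (Blinfun f) z = blinfun_apply
      (\<Sum>a\<in>UNIV. \<Sum>b\<in>UNIV. (f (axis b 1) $ a) *\<^sub>R Blinfun (\<lambda>z. (z $ b) *\<^sub>R axis a 1)) z"
    by (simp add: blinfun.sum_left blinfun.scaleR_left blinfun_apply_Blinfun u assms)
qed

lemma Ck_on_Blinfun:
  fixes M :: "'a::real_normed_vector \<Rightarrow> real^'n \<Rightarrow> real^'m"
  assumes "open S" "\<And>x. linear (M x)" "\<And>a b. Ck_on k S (\<lambda>x. M x (axis b 1) $ a)"
  shows "Ck_on k S (\<lambda>x. Blinfun (M x))"
  unfolding Blinfun_matrix_expansion[OF assms(2)]
  by (intro Ck_on_sum Ck_on_bilinear[OF _ bounded_bilinear_scaleR] assms Ck_on_const)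

lemma Ck_on_Pair:
  assumes "open S" "Ck_on k S f" "Ck_on k S g"
  shows "Ck_on k S (\<lambda>x. (f x, g x))"
proof -
  have "Ck_on k S (\<lambda>x. (f x, 0) + (0, g x))"
    by (intro Ck_on_add Ck_on_bounded_linear_compose[where L = "\<lambda>y. (y, 0)"]
        Ck_on_bounded_linear_compose[where L = "\<lambda>y. (0, y)"] assms
        bounded_linear_Pair bounded_linear_ident bounded_linear_zero)
  then show ?thesis by simp
qed

lemma inv_into_linear:
  assumes "linear f" "bij f"
  shows "linear (inv_into UNIV f)"
proof -
  have "inj f" using assms(2) by (rule bij_is_inj)
  have f: "f (inv_into UNIV f z) = z" for z
    using assms(2) by (simp add: bij_is_surj surj_f_inv_f)
  show ?thesis
    by (rule linearI; rule injD[OF \<open>inj f\<close>])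
      (simp_all add: f linear_add[OF assms(1)] linear_scale[OF assms(1)])
qed

lemma linear_in_lie_auto_bch:
  fixes h :: "'h::euclidean_space \<Rightarrow> 'h \<Rightarrow> 'h"
  assumes "linear f" "bij f"
    and "\<And>x y. f (x \<otimes>\<^bsub>bch_group h\<^esub> y) = f x \<otimes>\<^bsub>bch_group h\<^esub> f y"
  shows "f \<in> lie_auto (bch_group h)"
proof -
  have "smooth_map vec_manifold vec_manifold f" if "linear f" for f :: "'h \<Rightarrow> 'h"
    using that by (intro smooth_map_vecI Ck_on_linear) (simp add: linear_conv_bounded_linear)
  note this[OF assms(1)] this[OF inv_into_linear[OF assms(1,2)]]
  moreover have "f \<in> auto (bch_group h)"
    using assms(2,3) by (simp add: auto_def hom_def Bij_def) (simp add: bch_group_def)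
  ultimately show ?thesis
    by (simp add: lie_auto_def) (simp add: bch_group_def)
qed

lemma frechet_derivative_linear:
  fixes f :: "'a::euclidean_space \<Rightarrow> 'b::real_normed_vector"
  shows "linear f \<Longrightarrow> frechet_derivative f (at x) = f"
  using frechet_derivative_at[of f f x] bounded_linear_imp_has_derivative[of f "at x"]
  by (simp add: linear_conv_bounded_linear)

lemma aff_embed_linear: "linear f \<Longrightarrow> aff_embed (h, f) = (h, Blinfun f)"
  by (simp add: aff_embed_def frechet_derivative_linear)

section \<open>The affine action of the model group\<close>

context affine_model
begin

text \<open>Here \<open>lin x\<close> is a dilation followed by a unipotent automorphism of \<open>n4\<close>, and \<open>orb x\<close> is
  the image of \<open>0\<close> under the group element \<open>x\<close>. The map \<open>orb\<close> is chosen to be bijective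
  and equivariant (\<open>orb_mult\<close>), so the action is conjugate to left translation.\<close>

definition lin :: "real^4 \<Rightarrow> real^4 \<Rightarrow> real^4" where
  "lin x z = (let u = dil (x $ i) z in u + (u $ 1) *\<^sub>R (x $ 2 *\<^sub>R ee 3 + x $ 3 *\<^sub>R ee 4))"

definition orb :: "real^4 \<Rightarrow> real^4" where
  "orb x = x + (x $ 1 * x $ 2 / 2) *\<^sub>R ee 3 + (x $ 1 * x $ 3 / 2 + x $ 1 ^ 2 * x $ 2 / 12) *\<^sub>R ee 4"

definition \<rho> :: "'g \<Rightarrow> (real^4) \<times> (real^4 \<Rightarrow> real^4)" where
  "\<rho> x = (orb (F x), lin (F x))"

definition dlin :: "real^4 \<Rightarrow> real^4 \<Rightarrow> real^4" where
  "dlin x z = (\<chi> j. x $ i * w $ j * z $ j) + (z $ 1) *\<^sub>R (x $ 2 *\<^sub>R ee 3 + x $ 3 *\<^sub>R ee 4)"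

definition \<phi> :: "'g \<Rightarrow> (real^4) \<times> ((real^4) \<Rightarrow>\<^sub>L (real^4))" where
  "\<phi> x = (F x, Blinfun (dlin (F x)))"

lemma exp_w_4: "exp (r * w $ 4) = exp (r * w $ 1) * (exp (r * w $ 1) * exp (r * w $ 2))"
  by (simp add: w_4 algebra_simps flip: exp_add)

lemma lin_nth [simp]:
  "lin x z $ 1 = exp (x $ i * w $ 1) * z $ 1"
  "lin x z $ 2 = exp (x $ i * w $ 2) * z $ 2"
  "lin x z $ 3 = exp (x $ i * w $ 1) * (exp (x $ i * w $ 2) * z $ 3 + z $ 1 * x $ 2)"
  "lin x z $ 4 = exp (x $ i * w $ 1) * (exp (x $ i * w $ 1) * exp (x $ i * w $ 2) * z $ 4 + z $ 1 * x $ 3)"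
  by (simp_all add: lin_def Let_def axis_def w_3 exp_w_4 algebra_simps exp_add)

lemma orb_nth [simp]:
  "orb x $ 1 = x $ 1" "orb x $ 2 = x $ 2" "orb x $ 3 = x $ 3 + x $ 1 * x $ 2 / 2"
  "orb x $ 4 = x $ 4 + x $ 1 * x $ 3 / 2 + x $ 1 ^ 2 * x $ 2 / 12"
  by (simp_all add: orb_def axis_def)

lemma dlin_nth [simp]:
  "dlin x z $ 1 = x $ i * w $ 1 * z $ 1"
  "dlin x z $ 2 = x $ i * w $ 2 * z $ 2"
  "dlin x z $ 3 = x $ i * (w $ 1 + w $ 2) * z $ 3 + z $ 1 * x $ 2"
  "dlin x z $ 4 = x $ i * (2 * w $ 1 + w $ 2) * z $ 4 + z $ 1 * x $ 3"
  by (simp_all add: dlin_def axis_def w_3 w_4)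

lemma linear_lin: "linear (lin x)" and linear_dlin: "linear (dlin x)"
  by (rule linearI; simp add: vec_eq_iff forall_4 algebra_simps)+

lemma lin_lin: "lin x (lin y z) = lin (x + dil (x $ i) y) z"
  by (simp add: vec_eq_iff forall_4 w_i w_3 algebra_simps exp_add)

lemma lin_0: "lin 0 = id"
  by (simp add: fun_eq_iff vec_eq_iff forall_4)

lemma bij_lin: "bij (lin x)"
proof (rule o_bij)
  let ?y = "- dil (- x $ i) x"
  have "?y + dil (?y $ i) x = 0" "x + dil (x $ i) ?y = 0"
    by (simp_all add: vec_eq_iff w_i flip: exp_add)
  then show "lin ?y \<circ> lin x = id" "lin x \<circ> lin ?y = id"
    unfolding fun_eq_iff comp_apply lin_lin by (simp_all add: lin_0)
qed

lemma lin_in_lie_auto: "lin x \<in> lie_auto (bch_group n4)"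
proof (rule linear_in_lie_auto_bch[OF linear_lin bij_lin])
  fix y z
  show "lin x (y \<otimes>\<^bsub>bch_group n4\<^esub> z) = lin x y \<otimes>\<^bsub>bch_group n4\<^esub> lin x z"
    unfolding vec_eq_iff forall_4 bch_n4_mult lin_nth
    by (intro conjI; simp add: algebra_simps diff_divide_distrib add_divide_distrib)
qed

text \<open>For \<open>x $ i = 0\<close> the dilation is trivial, and the points
  \<open>orb (s *\<^sub>R x)\<close> form the orbit of \<open>0\<close> under the one-parameter
  group generated by the pair of \<open>x\<close> and \<open>dlin x\<close>. Integrating its
  velocity field from \<open>0\<close> gives the coefficients 1/2 and 1/12 of
  \<open>orb\<close>.\<close>

lemma orb_mult: "orb x \<otimes>\<^bsub>bch_group n4\<^esub> lin x (orb y) = orb (x + dil (x $ i) y)"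
  unfolding vec_eq_iff forall_4 bch_n4_mult lin_nth orb_nth
  by (intro conjI; simp add: algebra_simps diff_divide_distrib add_divide_distrib power2_eq_square
      w_3 exp_w_4 exp_add)

lemma bij_orb: "bij orb"
proof (rule o_bij)
  let ?q = "\<lambda>y::real^4. y - (y $ 1 * y $ 2 / 2) *\<^sub>R ee 3
    - (y $ 1 * (y $ 3 - y $ 1 * y $ 2 / 2) / 2 + y $ 1 ^ 2 * y $ 2 / 12) *\<^sub>R ee 4"
  show "?q \<circ> orb = id" "orb \<circ> ?q = id"
    unfolding fun_eq_iff comp_apply id_apply vec_eq_iff forall_4 by (simp_all add: axis_def)
qed

lemma \<rho>_hom: "\<rho> \<in> hom G (Aff (bch_group n4))"
proof (rule homI)
  fix x y
  show "\<rho> x \<in> carrier (Aff (bch_group n4))"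
    by (simp add: Aff_def \<rho>_def lin_in_lie_auto) (simp add: bch_group_def)
  have "compose (carrier (bch_group n4)) (lin (F x)) (lin (F y)) = lin (F (x \<otimes>\<^bsub>G\<^esub> y))"
    by (simp add: bch_group_def fun_eq_iff compose_def F_mult lin_lin)
  then show "\<rho> (x \<otimes>\<^bsub>G\<^esub> y) = \<rho> x \<otimes>\<^bsub>Aff (bch_group n4)\<^esub> \<rho> y"
    by (simp add: Aff_def \<rho>_def F_mult orb_mult)
qed

lemma aff_embed_\<rho>: "aff_embed (\<rho> x) = (orb (F x), Blinfun (lin (F x)))"
  by (simp add: \<rho>_def aff_embed_linear linear_lin)

lemma Ck_on_\<rho>: "Ck_on k UNIV (\<lambda>x. aff_embed (\<rho> x))"
proof -
  note bilin = Ck_on_bilinear[OF open_UNIV bounded_bilinear_mult]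
  have c: "Ck_on k UNIV (\<lambda>x. F x $ j)" for j
    by (rule Ck_on_linear[OF bl_F_nth])
  have e: "Ck_on k UNIV (\<lambda>x. exp (F x $ i * w $ j))" for j
    by (intro Ck_on_exp_linear open_UNIV bounded_linear_compose[OF bounded_linear_mult_left bl_F_nth])
  have "\<forall>j. Ck_on k UNIV (\<lambda>x. orb (F x) $ j)"
    unfolding forall_4 orb_nth power2_eq_square divide_inverse
    by (intro conjI Ck_on_add open_UNIV bilin c Ck_on_const)
  moreover have "\<forall>a. Ck_on k UNIV (\<lambda>x. lin (F x) (axis b 1) $ a)" for b
    unfolding forall_4 lin_nth
    by (intro conjI Ck_on_add open_UNIV bilin c e Ck_on_const)
  ultimately show ?thesis
    unfolding aff_embed_\<rho>
    by (intro Ck_on_Pair Ck_on_axis Ck_on_Blinfun open_UNIV linear_lin) auto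
qed

lemma lie_morphism_\<rho>: "lie_morphism_to_Aff G (bch_group n4) \<rho>"
  using \<rho>_hom smooth_map_vecI[OF Ck_on_\<rho>] by (simp add: lie_morphism_to_Aff_def) (simp add: G_def)

text \<open>Smoothness already provides some derivative \<open>D\<close>. By uniqueness it suffices
  to differentiate real functions: the coordinates of the translation part, and those of the linear
  part evaluated at a fixed vector.\<close>

lemma aff_differential_\<rho>: "aff_differential G (UNIV, id) \<rho> v = \<phi> v"
proof -
  have "(\<lambda>x. aff_embed (\<rho> x)) differentiable (at 0)"
    using Ck_on_\<rho>[of 1] by simp
  then obtain D where D: "((\<lambda>x. aff_embed (\<rho> x)) has_derivative D) (at 0)"
    unfolding differentiable_def by blast
  have nth: "((\<lambda>x. F x $ j) has_derivative (\<lambda>v. F v $ j)) (at 0)" for j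
    by (rule bounded_linear_imp_has_derivative[OF bl_F_nth])
  note F0 = linear_0[OF linear_F]
  have fst: "fst (D v) = F v"
  proof -
    have "((\<lambda>x. orb (F x) $ j) has_derivative (\<lambda>v. fst (D v) $ j)) (at 0)" for j
      using bounded_linear.has_derivative[OF bounded_linear_vec_nth has_derivative_fst[OF D]]
      by (simp add: aff_embed_\<rho>)
    moreover have "\<forall>j. ((\<lambda>x. orb (F x) $ j) has_derivative (\<lambda>v. F v $ j)) (at 0)"
      unfolding forall_4 orb_nth
      by (intro conjI) (auto intro!: derivative_eq_intros nth simp: F0)
    ultimately show ?thesis
      using has_derivative_unique unfolding vec_eq_iff by metis
  qed
  have snd: "snd (D v) = Blinfun (dlin (F v))"
  proof (rule blinfun_eqI)
    fix z :: "real^4"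
    have "bounded_linear (\<lambda>B :: (real^4) \<Rightarrow>\<^sub>L (real^4). blinfun_apply B z $ j)" for j
      using bounded_linear_compose[OF bounded_linear_vec_nth blinfun.bounded_linear_left] .
    from bounded_linear.has_derivative[OF this has_derivative_snd[OF D]]
    have "((\<lambda>x. lin (F x) z $ j) has_derivative (\<lambda>v. blinfun_apply (snd (D v)) z $ j)) (at 0)" for j
      by (simp add: aff_embed_\<rho> blinfun_apply_Blinfun linear_lin)
    moreover have "\<forall>j. ((\<lambda>x. lin (F x) z $ j) has_derivative (\<lambda>v. dlin (F v) z $ j)) (at 0)"
      unfolding forall_4 lin_nth dlin_nth
      by (intro conjI) (auto intro!: derivative_eq_intros nth simp: F0 algebra_simps)
    ultimately have "blinfun_apply (snd (D v)) z = dlin (F v) z"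
      using has_derivative_unique unfolding vec_eq_iff by metis
    then show "blinfun_apply (snd (D v)) z = blinfun_apply (Blinfun (dlin (F v))) z"
      by (simp add: blinfun_apply_Blinfun linear_dlin)
  qed
  have "aff_differential G (UNIV, id) \<rho> = D"
    using frechet_derivative_at[OF D] by (simp add: aff_differential_def G_def)
  then show ?thesis using fst snd by (simp add: \<phi>_def prod_eq_iff)
qed

lemma aff_morphism_\<phi>: "aff_morphism bracket n4 \<phi>"
  unfolding aff_morphism_def
proof (intro conjI allI)
  show "linear \<phi>"
    by (rule linearI; simp add: \<phi>_def linear_add[OF linear_F] linear_scale[OF linear_F];
        rule blinfun_eqI; simp add: blinfun.add_left blinfun.scaleR_left blinfun_apply_Blinfun linear_dlin
          vec_eq_iff forall_4 algebra_simps)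
  show "derivation n4 (snd (\<phi> x))" for x
    by (simp add: derivation_def \<phi>_def blinfun_apply_Blinfun linear_dlin vec_eq_iff forall_4 algebra_simps)
  show "\<phi> (bracket x y) = aff_bracket n4 (\<phi> x) (\<phi> y)" for x y
  proof -
    have "F (bracket x y) = n4 (F x) (F y) + dlin (F x) (F y) - dlin (F y) (F x)"
      by (simp add: bracket_def vec_eq_iff forall_4 w_3 w_4 algebra_simps)
    moreover have "Blinfun (dlin (F (bracket x y))) =
      (Blinfun (dlin (F x)) o\<^sub>L Blinfun (dlin (F y))) - (Blinfun (dlin (F y)) o\<^sub>L Blinfun (dlin (F x)))"
      by (rule blinfun_eqI)
        (simp add: blinfun.diff_left blinfun_apply_Blinfun linear_dlin vec_eq_iff forall_4 
          bracket_def w_i w_3 algebra_simps)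
    ultimately show ?thesis
      by (simp add: \<phi>_def aff_bracket_def blinfun_apply_Blinfun linear_dlin)
  qed
qed

lemma simply_transitive_\<phi>: "simply_transitive_action bracket n4 \<phi>"
proof -
  have "\<exists>!a. a \<in> carrier G \<and> aff_act (bch_group n4) (\<rho> a) x = y" for x y
  proof -
    obtain x' y' where x: "x = orb (F x')" and y: "y = orb (F y')"
      using bij_orb F_F' by (metis bij_pointE)
    interpret Group.group G by (rule group_G)
    have "aff_act (bch_group n4) (\<rho> a) x = y \<longleftrightarrow> a \<otimes>\<^bsub>G\<^esub> x' = y'" for a
      unfolding x y using bij_orb bij_F
      by (simp add: aff_act_def \<rho>_def orb_mult bij_is_inj inj_eq flip: F_mult)
    moreover have "carrier G = UNIV" by (simp add: G_def)
    ultimately show ?thesis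
      by (metis UNIV_I inv_solve_right)
  qed
  then show ?thesis
    unfolding simply_transitive_action_def
    using aff_morphism_\<phi> one_connected_G lie_morphism_\<rho> aff_differential_\<rho> id_apply by metis
qed

end

section \<open>The four algebras of the family \<open>r4\<close> that act\<close>

lemma vector_4 [simp]:
  "(vector [a, b, c, d] :: 'a::zero^4) $ 1 = a" "(vector [a, b, c, d] :: 'a::zero^4) $ 2 = b"
  "(vector [a, b, c, d] :: 'a::zero^4) $ 3 = c" "(vector [a, b, c, d] :: 'a::zero^4) $ 4 = d"
  unfolding vector_def by simp_all

lemma r4_nth:
  "r4 \<mu> \<nu> x y $ k = (vector [0, 1, \<mu>, \<nu>] :: real^4) $ k * (x $ 1 * y $ k - x $ k * y $ 1)"
proof -
  have "\<forall>k. r4 \<mu> \<nu> x y $ k = (vector [0, 1, \<mu>, \<nu>] :: real^4) $ k * (x $ 1 * y $ k - x $ k * y $ 1)"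
    by (simp add: forall_4 r4_def wedge_def axis_def)
  then show ?thesis ..
qed

text \<open>\<open>\<pi>\<close> tells which eigenvalue \<open>0, 1, \<mu>, \<nu>\<close> of
  \<open>ad e_1\<close> is used as which weight on \<open>n4\<close>. The acting coordinate
  \<open>i\<close> of the model has to be the one sent to the eigenvalue 0 of \<open>e_1\<close>
  itself.\<close>

lemma r4_simply_transitive:
  fixes g :: "'g::euclidean_space \<Rightarrow> 'g \<Rightarrow> 'g" and \<pi> :: "4 \<Rightarrow> 4"
  assumes "lie_isomorphic g (r4 \<mu> \<nu>)" "inj \<pi>" "\<pi> i = 1"
    and "w = (\<chi> j. (vector [0, 1, \<mu>, \<nu>] :: real^4) $ \<pi> j)"
    and "w $ 3 = w $ 1 + w $ 2" "w $ 4 = 2 * w $ 1 + w $ 2"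
  shows "\<exists>\<phi>. simply_transitive_action g n4 \<phi>"
proof -
  obtain f where f: "linear f" "bij f" "\<And>x y. f (g x y) = r4 \<mu> \<nu> (f x) (f y)"
    using assms(1) by (auto simp: lie_isomorphic_def lie_iso_def)
  have bij_\<pi>: "bij \<pi>"
    using assms(2) by (simp add: bij_def finite_UNIV_inj_surj)
  define F where "F x = (\<chi> j. f x $ \<pi> j)" for x
  have "linear F"
    by (rule linearI) (simp_all add: F_def vec_eq_iff linear_add[OF f(1)] linear_scale[OF f(1)])
  moreover have "inj F"
  proof (rule injI)
    fix x y assume "F x = F y"
    then have "f x $ \<pi> j = f y $ \<pi> j" for j by (simp add: F_def vec_eq_iff)
    then have "f x $ k = f y $ k" for k using bij_\<pi> by (metis bij_pointE)
    then show "x = y" using f(2) by (metis vec_eq_iff bij_is_inj injD)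
  qed
  moreover have "surj F"
  proof (rule surjI)
    fix z :: "real^4"
    let ?z = "\<chi> k. z $ inv_into UNIV \<pi> k"
    have "f (inv_into UNIV f ?z) = ?z"
      using f(2) by (simp add: bij_is_surj surj_f_inv_f)
    then show "F (inv_into UNIV f ?z) = z"
      using assms(2) by (simp add: F_def vec_eq_iff)
  qed
  moreover have "w $ i = 0"
    using assms(3,4) by simp
  ultimately have "affine_model F w i"
    using assms(5,6) by (simp add: affine_model_def bij_def)
  then interpret affine_model F w i .
  have "bracket x y = g x y" for x y
    by (rule F_eqI) (simp add: bracket_def, simp add: F_def f(3) r4_nth assms(3,4) vec_eq_iff)
  then show ?thesis
    using simply_transitive_\<phi> by (metis ext)
qed

text \<open>The permutations come from the weight lists (0, 1, 1, 1), (1/2, 0, 1/2, 1), (-1, 1, 0,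
  -1) and (-1/2, 1, 1/2, 0): each has the shape \<open>a, e, a + e, 2 * a + e\<close>, with the
  single zero in position \<open>i\<close>.\<close>

lemma r4_special_simply_transitive:
  assumes "\<mu> = \<nu> \<and> \<nu> \<in> {-1, 1/2, 1} \<or> \<mu> = -1/2 \<and> \<nu> = 1/2" "lie_isomorphic g (r4 \<mu> \<nu>)"
  shows "\<exists>\<phi>. simply_transitive_action g n4 \<phi>"
proof -
  consider "\<mu> = 1" "\<nu> = 1" | "\<mu> = 1/2" "\<nu> = 1/2" | "\<mu> = -1" "\<nu> = -1" | "\<mu> = -1/2" "\<nu> = 1/2"
    using assms(1) by auto
  then show ?thesis
  proof cases
    case 1
    show ?thesis
      by (rule r4_simply_transitive[OF assms(2), where \<pi> = "\<lambda>j. j" and i = 1, OF _ _ refl])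
        (simp_all add: 1)
  next
    case 2
    show ?thesis
      by (rule r4_simply_transitive[OF assms(2), where \<pi> = "($) (vector [3, 1, 4, 2])" and i = 2, OF _ _ refl])
        (simp_all add: 2 inj_def forall_4)
  next
    case 3
    show ?thesis
      by (rule r4_simply_transitive[OF assms(2), where \<pi> = "($) (vector [3, 2, 1, 4])" and i = 3, OF _ _ refl])
        (simp_all add: 3 inj_def forall_4)
  next
    case 4
    show ?thesis
      by (rule r4_simply_transitive[OF assms(2), where \<pi> = "($) (vector [3, 2, 4, 1])" and i = 4, OF _ _ refl])
        (simp_all add: 4 inj_def forall_4)
  qed
qed

section \<open>The infinitesimal action of a simply transitive action is injective\<close>

text \<open>Doubling is squaring in the group, so \<alpha> commutes with it. The difference
  \<open>e\<close> between \<alpha> and its derivative at \<open>0\<close> then scales by powers of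
  2 but is of smaller than linear order at \<open>0\<close>, hence vanishes. Thus the embedding by
  the differential loses nothing of \<alpha>.\<close>

lemma lie_auto_bch_linear:
  fixes h :: "'h::euclidean_space \<Rightarrow> 'h \<Rightarrow> 'h"
  assumes "lie_algebra h" "\<alpha> \<in> lie_auto (bch_group h)"
  shows "linear \<alpha>"
proof -
  have h: "h x x = 0" "h x 0 = 0" for x
    using assms(1) by (simp_all add: lie_algebra_def bilinear_rzero)
  have hom: "\<alpha> \<in> hom (bch_group h) (bch_group h)" and "smooth_map vec_manifold vec_manifold \<alpha>"
    using assms(2) by (auto simp: lie_auto_def auto_def bch_group_def)
  then have "Ck_on 1 UNIV \<alpha>"
    by (simp add: smooth_map_def vec_manifold_def smooth_on_def id_def)
  then obtain D where D: "(\<alpha> has_derivative D) (at 0)"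
    by (auto simp: differentiable_def)
  then have lin: "linear D" by (rule has_derivative_linear)
  define e where "e x = \<alpha> x - D x" for x
  have "\<alpha> (x \<otimes>\<^bsub>bch_group h\<^esub> x) = \<alpha> x \<otimes>\<^bsub>bch_group h\<^esub> \<alpha> x" for x
    by (rule hom_mult[OF hom]) (simp_all add: bch_group_def)
  then have double: "\<alpha> (x + x) = \<alpha> x + \<alpha> x" for x
    by (simp add: bch_group_def h)
  then have \<alpha>0: "\<alpha> 0 = 0" using double[of 0] by simp
  have "e (x + x) = e x + e x" for x
    by (simp add: e_def double linear_add[OF lin])
  then have e2: "e (2 *\<^sub>R x) = 2 *\<^sub>R e x" for x
    by (simp add: scaleR_2)
  have e_pow: "e (2 ^ n *\<^sub>R x) = 2 ^ n *\<^sub>R e x" for n x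
  proof (induction n)
    case (Suc n)
    then show ?case using e2[of "2 ^ n *\<^sub>R x"] by simp
  qed simp
  have "e x = 0" for x
  proof (rule ccontr)
    assume "e x \<noteq> 0"
    then have pos: "norm (e x) > 0" by simp
    \<comment> \<open>Any positive slope below the ratio of \<open>norm (e x)\<close> to
      \<open>norm x\<close> would do; adding 1 also covers \<open>x = 0\<close>.\<close>
    define c where "c = norm (e x) / (norm x + 1)"
    have x: "norm x + 1 > 0" by (simp add: add_nonneg_pos)
    have c0: "c > 0" using pos x unfolding c_def by (rule divide_pos_pos)
    have "norm (e x) = c * (norm x + 1)" using x by (simp add: c_def)
    then have c: "c * norm x < norm (e x)" using c0 by (simp add: distrib_left)
    obtain d where d: "d > 0" "\<And>y. norm y < d \<Longrightarrow> norm (e y) \<le> c * norm y"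
      using D c0 unfolding has_derivative_at_alt e_def by (auto simp: \<alpha>0)
    obtain n where n: "norm x / d < 2 ^ n"
      using real_arch_pow[of 2 "norm x / d"] by auto
    let ?y = "(1 / 2 ^ n) *\<^sub>R x"
    have "norm ?y < d"
      using n d(1) by (simp add: field_simps)
    then have "norm (e ?y) \<le> c * norm ?y" by (rule d(2))
    moreover have "e x = 2 ^ n *\<^sub>R e ?y" using e_pow[of n ?y] by simp
    ultimately have "norm (e x) \<le> c * norm x"
      by (simp add: field_simps)
    with c show False by simp
  qed
  then have "\<alpha> = D" by (auto simp: e_def fun_eq_iff)
  with lin show ?thesis by simp
qed

section \<open>Charts and translations of an abstract Lie group\<close>

lemma chart_facts:
  assumes "smooth_manifold M" "(U, \<psi>) \<in> atlas M"
  shows "inj_on \<psi> U" "open (\<psi> ` U)" "openin (mtop M) U"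
    "\<And>W. openin (mtop M) W \<Longrightarrow> W \<subseteq> U \<Longrightarrow> open (\<psi> ` W)"
proof -
  have U: "openin (mtop M) U" "open (\<psi> ` U)"
    and hom: "homeomorphic_map (subtopology (mtop M) U) (top_of_set (\<psi> ` U)) \<psi>"
    using assms by (auto simp: smooth_manifold_def)
  have top: "topspace (subtopology (mtop M) U) = U"
    using U(1) openin_subset by (auto simp: topspace_subtopology)
  show "inj_on \<psi> U"
    using homeomorphic_imp_injective_map[OF hom] top by simp
  show "open (\<psi> ` U)" "openin (mtop M) U" by (fact U)+
  show "open (\<psi> ` W)" if "openin (mtop M) W" "W \<subseteq> U" for W
  proof -
    have "openin (subtopology (mtop M) U) W"
      using that by (auto simp: openin_subtopology intro!: exI[of _ W])
    then have "openin (top_of_set (\<psi> ` U)) (\<psi> ` W)"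
      using homeomorphic_imp_open_map[OF hom] by (simp add: open_map_def)
    then show ?thesis using U(2) by (rule openin_open_trans)
  qed
qed

lemma continuous_map_left_translation:
  assumes "lie_group G" "b \<in> carrier G"
  shows "continuous_map (mtop (mfd G)) (mtop (mfd G)) (\<lambda>a. b \<otimes>\<^bsub>G\<^esub> a)"
proof -
  have m: "continuous_map (prod_topology (mtop (mfd G)) (mtop (mfd G))) (mtop (mfd G)) (\<lambda>(x, y). x \<otimes>\<^bsub>G\<^esub> y)"
    using assms(1) by (simp add: lie_group_def smooth_map_def prod_manifold_def)
  have "continuous_map (mtop (mfd G)) (prod_topology (mtop (mfd G)) (mtop (mfd G))) (\<lambda>a. (b, a))"
    using assms by (auto simp: continuous_map_pairedI lie_group_def)
  from continuous_map_compose[OF this m] show ?thesis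
    by (simp add: comp_def)
qed

lemma openin_left_translate_preimage:
  assumes "lie_group G" "b \<in> carrier G" "openin (mtop (mfd G)) U"
  shows "openin (mtop (mfd G)) {a \<in> carrier G. b \<otimes>\<^bsub>G\<^esub> a \<in> U}"
  using openin_continuous_map_preimage[OF continuous_map_left_translation[OF assms(1,2)] assms(3)] assms(1)
  by (simp add: lie_group_def)

lemma Ck_on_1_differentiable: "Ck_on 1 S f \<Longrightarrow> x \<in> S \<Longrightarrow> f differentiable (at x)"
  by simp

text \<open>Smoothness of the multiplication is available in product charts only, and
  \<open>b\<close> may lie outside \<open>U\<close>. So a second chart \<open>V\<close> around
  \<open>b\<close> is used, and the product is restricted to the slice with first coordinate
  \<open>\<eta> b\<close>.\<close>

lemma left_translation_differentiable:
  assumes G: "lie_group G" and chart: "(U, \<psi>) \<in> atlas (mfd G)"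
    and b: "b \<in> carrier G" and a: "a \<in> U" "b \<otimes>\<^bsub>G\<^esub> a \<in> U"
  shows "(\<lambda>p. \<psi> (b \<otimes>\<^bsub>G\<^esub> inv_into U \<psi> p)) differentiable (at (\<psi> a))"
proof -
  have M: "smooth_manifold (mfd G)" and top: "topspace (mtop (mfd G)) = carrier G"
    using G by (simp_all add: lie_group_def)
  obtain V \<eta> where V: "(V, \<eta>) \<in> atlas (mfd G)" "b \<in> V"
    using M b top unfolding smooth_manifold_def by blast
  let ?D = "map_prod \<eta> \<psi> ` {x \<in> V \<times> U. (case x of (x, y) \<Rightarrow> x \<otimes>\<^bsub>G\<^esub> y) \<in> U}"
  let ?m = "\<lambda>p. \<psi> (case inv_into (V \<times> U) (map_prod \<eta> \<psi>) p of (x, y) \<Rightarrow> x \<otimes>\<^bsub>G\<^esub> y)"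
  have "(V \<times> U, map_prod \<eta> \<psi>) \<in> atlas (prod_manifold (mfd G) (mfd G))"
    using V(1) chart by (auto simp: prod_manifold_def)
  moreover have "smooth_map (prod_manifold (mfd G) (mfd G)) (mfd G) (\<lambda>(x, y). x \<otimes>\<^bsub>G\<^esub> y)"
    using G by (simp add: lie_group_def)
  ultimately have "smooth_on ?D ?m"
    using chart unfolding smooth_map_def by blast
  then have "Ck_on 1 ?D ?m" by (simp only: smooth_on_def)
  moreover have "(\<eta> b, \<psi> a) \<in> ?D" using V(2) a by force
  ultimately have m: "?m differentiable (at (\<eta> b, \<psi> a))" by (rule Ck_on_1_differentiable)
  have inj: "inj_on (map_prod \<eta> \<psi>) (V \<times> U)"
    using chart_facts(1)[OF M V(1)] chart_facts(1)[OF M chart] by (rule map_prod_inj_on)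
  have eq: "?m (\<eta> b, q) = \<psi> (b \<otimes>\<^bsub>G\<^esub> inv_into U \<psi> q)" if "q \<in> \<psi> ` U" for q
  proof -
    have "inv_into (V \<times> U) (map_prod \<eta> \<psi>) (\<eta> b, q) = (b, inv_into U \<psi> q)"
      using inj V(2) that by (intro inv_into_f_eq) (auto simp: inv_into_into f_inv_into_f)
    then show ?thesis by simp
  qed
  have "((\<lambda>q. (\<eta> b, q)) has_derivative (\<lambda>v. (0, v))) (at (\<psi> a))"
    by (intro has_derivative_Pair has_derivative_const has_derivative_ident)
  moreover obtain D where "(?m has_derivative D) (at (\<eta> b, \<psi> a))"
    using m unfolding differentiable_def by blast
  ultimately have "((\<lambda>q. ?m (\<eta> b, q)) has_derivative (\<lambda>v. D (0, v))) (at (\<psi> a))"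
    by (rule has_derivative_compose)
  then have "((\<lambda>p. \<psi> (b \<otimes>\<^bsub>G\<^esub> inv_into U \<psi> p)) has_derivative (\<lambda>v. D (0, v))) (at (\<psi> a))"
    by (rule has_derivative_transform_within_open[OF _ chart_facts(2)[OF M chart]]) (use a eq in auto)
  then show ?thesis unfolding differentiable_def by blast
qed

text \<open>A Lindelof argument: for every basic open set contained in some translate of
  \<open>U\<close>, one such translate is chosen. Countability matters because negligibility
  survives only countable unions.\<close>

lemma countable_translates_cover:
  assumes G: "lie_group G" and U: "openin (mtop (mfd G)) U" "\<one>\<^bsub>G\<^esub> \<in> U"
  obtains A where "countable A" "A \<subseteq> carrier G" "carrier G \<subseteq> (\<Union>a\<in>A. (\<lambda>x. a \<otimes>\<^bsub>G\<^esub> x) ` U)"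
proof -
  interpret Group.group G using G by (simp add: lie_group_def)
  have top: "topspace (mtop (mfd G)) = carrier G" using G by (simp add: lie_group_def)
  then have U_sub: "U \<subseteq> carrier G" using openin_subset[OF U(1)] by simp
  have tr: "{x \<in> carrier G. inv\<^bsub>G\<^esub> a \<otimes>\<^bsub>G\<^esub> x \<in> U} = (\<lambda>x. a \<otimes>\<^bsub>G\<^esub> x) ` U" if a: "a \<in> carrier G" for a
  proof
    show "{x \<in> carrier G. inv\<^bsub>G\<^esub> a \<otimes>\<^bsub>G\<^esub> x \<in> U} \<subseteq> (\<lambda>x. a \<otimes>\<^bsub>G\<^esub> x) ` U"
    proof
      fix x assume x: "x \<in> {x \<in> carrier G. inv\<^bsub>G\<^esub> a \<otimes>\<^bsub>G\<^esub> x \<in> U}"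
      then have "x = a \<otimes>\<^bsub>G\<^esub> (inv\<^bsub>G\<^esub> a \<otimes>\<^bsub>G\<^esub> x)" using a by (simp flip: m_assoc)
      then show "x \<in> (\<lambda>x. a \<otimes>\<^bsub>G\<^esub> x) ` U" using x by blast
    qed
    show "(\<lambda>x. a \<otimes>\<^bsub>G\<^esub> x) ` U \<subseteq> {x \<in> carrier G. inv\<^bsub>G\<^esub> a \<otimes>\<^bsub>G\<^esub> x \<in> U}"
    proof
      fix y assume "y \<in> (\<lambda>x. a \<otimes>\<^bsub>G\<^esub> x) ` U"
      then obtain x where x: "y = a \<otimes>\<^bsub>G\<^esub> x" "x \<in> U" "x \<in> carrier G" using U_sub by blast
      have "inv\<^bsub>G\<^esub> a \<otimes>\<^bsub>G\<^esub> y = x" using a x by (simp flip: m_assoc)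
      then show "y \<in> {x \<in> carrier G. inv\<^bsub>G\<^esub> a \<otimes>\<^bsub>G\<^esub> x \<in> U}" using a x by simp
    qed
  qed
  have "second_countable_space (mtop (mfd G))"
    using G by (simp add: lie_group_def smooth_manifold_def)
  then obtain B where "countable B \<and> (\<forall>V\<in>B. openin (mtop (mfd G)) V) \<and>
      (\<forall>W x. openin (mtop (mfd G)) W \<and> x \<in> W \<longrightarrow> (\<exists>V\<in>B. x \<in> V \<and> V \<subseteq> W))"
    unfolding second_countable_space_def by (rule exE)
  note B = this[THEN conjunct1] this[THEN conjunct2, THEN conjunct2]
  define s where "s V = (SOME a. a \<in> carrier G \<and> V \<subseteq> (\<lambda>x. a \<otimes>\<^bsub>G\<^esub> x) ` U)" for V
  let ?C = "{V \<in> B. \<exists>a. a \<in> carrier G \<and> V \<subseteq> (\<lambda>x. a \<otimes>\<^bsub>G\<^esub> x) ` U}"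
  have s: "s V \<in> carrier G \<and> V \<subseteq> (\<lambda>x. s V \<otimes>\<^bsub>G\<^esub> x) ` U" if "V \<in> ?C" for V
    unfolding s_def by (rule someI_ex) (use that in blast)
  have "x \<in> (\<Union>a\<in>s ` ?C. (\<lambda>x. a \<otimes>\<^bsub>G\<^esub> x) ` U)" if x: "x \<in> carrier G" for x
  proof -
    have "x \<in> (\<lambda>y. x \<otimes>\<^bsub>G\<^esub> y) ` U" using U(2) x by force
    moreover have "openin (mtop (mfd G)) ((\<lambda>y. x \<otimes>\<^bsub>G\<^esub> y) ` U)"
      using openin_left_translate_preimage[OF G inv_closed[OF x] U(1)] tr[OF x] by simp
    ultimately obtain V where V: "V \<in> B" "x \<in> V" "V \<subseteq> (\<lambda>y. x \<otimes>\<^bsub>G\<^esub> y) ` U"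
      using B(2)[rule_format, OF conjI] by blast
    then have "V \<in> ?C" using x by blast
    with s[OF this] V(2) show ?thesis by blast
  qed
  then show thesis
    using B(1) s by (intro that[of "s ` ?C"]) auto
qed

text \<open>The value at \<open>y\<close> of the vector field on \<open>bch_group n4\<close> given by an element of
  \<open>aff n4\<close>: the derivative at the identity of \<open>blin_act y\<close>.\<close>

definition aff_velocity :: "real^4 \<Rightarrow> (real^4) \<times> ((real^4) \<Rightarrow>\<^sub>L (real^4)) \<Rightarrow> real^4" where
  "aff_velocity y T = fst T + snd T y + (1/2) *\<^sub>R n4 (fst T) y + (1/12) *\<^sub>R n4 y (n4 y (fst T))"

text \<open>The action formula on the whole vector space of pairs, with no condition on the
  operator, so that it can be differentiated and composed with \<open>aff_embed\<close> by the chain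
  rule.\<close>

definition blin_act :: "real^4 \<Rightarrow> (real^4) \<times> ((real^4) \<Rightarrow>\<^sub>L (real^4)) \<Rightarrow> real^4" where
  "blin_act y T = fst T \<otimes>\<^bsub>bch_group n4\<^esub> snd T y"

lemma blin_act_has_derivative: "(blin_act y has_derivative aff_velocity y) (at (0, id_blinfun))"
proof -
  interpret n4: bounded_bilinear n4 by (rule bounded_bilinear_n4)
  have f: "(fst has_derivative fst) (at T)"
    for T :: "(real^4) \<times> ((real^4) \<Rightarrow>\<^sub>L (real^4))"
    by (rule bounded_linear_imp_has_derivative[OF bounded_linear_fst])
  have s: "((\<lambda>T. blinfun_apply (snd T) y) has_derivative (\<lambda>T. blinfun_apply (snd T) y)) (at T)"
    for T :: "(real^4) \<times> ((real^4) \<Rightarrow>\<^sub>L (real^4))"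
    by (rule bounded_linear_imp_has_derivative)
      (rule bounded_linear_compose[OF blinfun.bounded_linear_left bounded_linear_snd])
  show ?thesis
    unfolding blin_act_def bch_group_def monoid.simps
    by (rule has_derivative_eq_rhs, rule has_derivative_add[OF
          has_derivative_add[OF has_derivative_add[OF f s]
            has_derivative_scaleR_right[OF n4.FDERIV[OF f s]]]
          has_derivative_scaleR_right[OF has_derivative_add[OF
            n4.FDERIV[OF f n4.FDERIV[OF f s]] n4.FDERIV[OF s n4.FDERIV[OF s f]]]]])
      (simp add: fun_eq_iff aff_velocity_def n4.zero_left n4.zero_right)
qed

lemma aff_act_differentiable:
  assumes "linear \<alpha>"
  shows "(\<lambda>x. aff_act (bch_group n4) (h, \<alpha>) x) differentiable (at x)"
proof -
  have a: "Ck_on k UNIV \<alpha>" for k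
    using assms by (intro Ck_on_linear) (simp add: linear_conv_bounded_linear)
  have "Ck_on 1 UNIV (\<lambda>x. aff_act (bch_group n4) (h, \<alpha>) x)"
    unfolding aff_act_def bch_group_def monoid.simps prod.case
    by (intro Ck_on_add Ck_on_scaleR Ck_on_bilinear[OF _ bounded_bilinear_n4] a open_UNIV Ck_on_const)
  then show ?thesis by (rule Ck_on_1_differentiable) simp
qed

text \<open>If the orbit map through \<open>y\<close> had a singular derivative at the identity, by equivariance it
  would have a singular derivative everywhere. By Sard's theorem its image would then be
  negligible, contradicting transitivity.\<close>

lemma simply_transitive_aff_velocity_inj:
  fixes g :: "'g::euclidean_space \<Rightarrow> 'g \<Rightarrow> 'g" and L :: "real^4 \<Rightarrow> 'g"
  assumes st: "simply_transitive_action g n4 \<phi>" and L: "linear L" "bij L"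
    and X: "aff_velocity y (\<phi> X) = 0"
  shows "X = 0"
proof (rule ccontr)
  assume "X \<noteq> 0"
  let ?H = "bch_group n4"
  obtain G :: "('g, 'g) lie_group" and c \<theta> \<rho> where *: "one_connected_lie_group_of G c \<theta> g \<and>
      lie_morphism_to_Aff G ?H \<rho> \<and> (\<forall>X. aff_differential G c \<rho> (\<theta> X) = \<phi> X) \<and>
      (\<forall>x\<in>carrier ?H. \<forall>y\<in>carrier ?H. \<exists>!a. a \<in> carrier G \<and> aff_act ?H (\<rho> a) x = y)"
    using st[unfolded simply_transitive_action_def, THEN conjunct2] by (elim exE) (rule that)
  have oc: "one_connected_lie_group_of G c \<theta> g" and mor: "lie_morphism_to_Aff G ?H \<rho>"
    and diff: "aff_differential G c \<rho> (\<theta> X) = \<phi> X" for X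
    using * by simp_all
  have trans: "\<exists>a. a \<in> carrier G \<and> aff_act ?H (\<rho> a) x = y" for x y
  proof -
    have "x \<in> carrier ?H" "y \<in> carrier ?H" by (simp_all add: bch_group_def)
    then show ?thesis using * by blast
  qed
  obtain U \<psi> where c: "c = (U, \<psi>)" by fastforce
  have G: "lie_group G" and chart: "(U, \<psi>) \<in> atlas (mfd G)" and one: "\<one>\<^bsub>G\<^esub> \<in> U"
    and \<theta>: "linear \<theta>" "inj \<theta>"
    using oc by (auto simp: one_connected_lie_group_of_def lie_iso_def bij_is_inj c)
  interpret Group.group G using G by (simp add: lie_group_def)
  have M: "smooth_manifold (mfd G)" and top: "topspace (mtop (mfd G)) = carrier G"
    using G by (simp_all add: lie_group_def)
  note chart_facts = chart_facts[OF M chart]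
  have U_sub: "U \<subseteq> carrier G" using openin_subset[OF chart_facts(3)] top by simp
  have hom: "\<rho> \<in> hom G (Aff ?H)" and smooth: "smooth_map (mfd G) vec_manifold (\<lambda>x. aff_embed (\<rho> x))"
    using mor by (simp_all add: lie_morphism_to_Aff_def)
  have auto: "snd (\<rho> a) \<in> lie_auto ?H" if "a \<in> carrier G" for a
    using hom_in_carrier[OF hom that] by (auto simp: Aff_def)
  then have lin: "linear (snd (\<rho> a))" if "a \<in> carrier G" for a
    using lie_auto_bch_linear[OF lie_algebra_n4] that by blast
  define f where "f a = aff_act ?H (\<rho> a) y" for a
  have f_eq: "f a = blin_act y (aff_embed (\<rho> a))" if "a \<in> carrier G" for a
    using lin[OF that] aff_embed_linear[OF lin[OF that], of "fst (\<rho> a)"]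
    by (simp add: f_def aff_act_def blin_act_def case_prod_beta blinfun_apply_Blinfun)
  have \<rho>_mult: "\<rho> (a \<otimes>\<^bsub>G\<^esub> b) = (fst (\<rho> a) \<otimes>\<^bsub>?H\<^esub> snd (\<rho> a) (fst (\<rho> b)), snd (\<rho> a) \<circ> snd (\<rho> b))"
    if "a \<in> carrier G" "b \<in> carrier G" for a b
    using hom_mult[OF hom that]
    by (simp add: Aff_def case_prod_beta compose_def comp_def) (simp add: bch_group_def restrict_def)
  have f_mult: "f (a \<otimes>\<^bsub>G\<^esub> b) = aff_act ?H (\<rho> a) (f b)" if "a \<in> carrier G" "b \<in> carrier G" for a b
  proof -
    have "snd (\<rho> a) \<in> hom ?H ?H" using auto[OF that(1)] by (auto simp: lie_auto_def auto_def)
    then have "snd (\<rho> a) (u \<otimes>\<^bsub>?H\<^esub> v) = snd (\<rho> a) u \<otimes>\<^bsub>?H\<^esub> snd (\<rho> a) v" for u v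
      by (rule hom_mult) (simp_all add: bch_group_def)
    moreover have "u \<otimes>\<^bsub>?H\<^esub> (v \<otimes>\<^bsub>?H\<^esub> w) = u \<otimes>\<^bsub>?H\<^esub> v \<otimes>\<^bsub>?H\<^esub> w" for u v w
      using monoid.m_assoc[OF group.is_monoid[OF bch_n4_group]] by (simp add: bch_group_def)
    ultimately show ?thesis
      by (simp add: f_def aff_act_def \<rho>_mult[OF that] case_prod_beta)
  qed
  \<comment> \<open>\<open>hom\<close> asks for multiplicativity only, so idempotence has to do: an
    injective idempotent map is the identity, and then \<open>?h\<close> times \<open>?h\<close>
    equal to \<open>?h\<close> leaves \<open>?h = 0\<close>.\<close>
  have embed_one: "aff_embed (\<rho> \<one>\<^bsub>G\<^esub>) = (0, id_blinfun)"
  proof -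
    let ?h = "fst (\<rho> \<one>\<^bsub>G\<^esub>)" and ?\<alpha> = "snd (\<rho> \<one>\<^bsub>G\<^esub>)"
    have eq: "?h = ?h \<otimes>\<^bsub>?H\<^esub> ?\<alpha> ?h" "?\<alpha> = ?\<alpha> \<circ> ?\<alpha>"
      using \<rho>_mult[OF one_closed one_closed] by (simp_all add: prod_eq_iff)
    have "inj ?\<alpha>"
      using auto[OF one_closed] by (auto simp: lie_auto_def auto_def Bij_def bij_betw_def bch_group_def)
    then have "?\<alpha> x = x" for x using eq(2) by (metis comp_apply injD)
    then have \<alpha>: "?\<alpha> = (\<lambda>x. x)" by blast
    have "?h = 0"
    proof -
      have "?h \<otimes>\<^bsub>?H\<^esub> ?h = ?h" using eq(1) \<alpha> by simp
      moreover have "n4 u u = 0" "n4 u 0 = 0" for u by (simp_all add: vec_eq_iff forall_4)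
      ultimately show ?thesis by (simp add: bch_group_def)
    qed
    then have "\<rho> \<one>\<^bsub>G\<^esub> = (0, \<lambda>x. x)" using \<alpha> by (simp add: prod_eq_iff)
    then show ?thesis
      using aff_embed_linear[OF lin[OF one_closed], of 0] \<alpha>
      by (simp add: id_blinfun_def id_def)
  qed
  define F where "F p = f (inv_into U \<psi> p)" for p
  have inv_U: "inv_into U \<psi> (\<psi> a) = a" if "a \<in> U" for a
    using chart_facts(1) that by (rule inv_into_f_f)
  have inv_mem: "inv_into U \<psi> p \<in> U" "\<psi> (inv_into U \<psi> p) = p" if "p \<in> \<psi> ` U" for p
    using that by (simp_all add: inv_into_into f_inv_into_f)
  define K where "K v = aff_velocity y (aff_differential G c \<rho> v)" for v
  have DF: "(F has_derivative K) (at (\<psi> \<one>\<^bsub>G\<^esub>))"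
  proof -
    have "smooth_on (\<psi> ` U) (\<lambda>p. aff_embed (\<rho> (inv_into U \<psi> p)))"
      using smooth chart by (auto simp: smooth_map_def vec_manifold_def)
    then have "(\<lambda>p. aff_embed (\<rho> (inv_into U \<psi> p))) differentiable (at (\<psi> \<one>\<^bsub>G\<^esub>))"
      unfolding smooth_on_def using one Ck_on_1_differentiable by blast
    then have "((\<lambda>p. aff_embed (\<rho> (inv_into U \<psi> p))) has_derivative aff_differential G c \<rho>) (at (\<psi> \<one>\<^bsub>G\<^esub>))"
      by (simp add: aff_differential_def c frechet_derivative_works)
    then have "((\<lambda>p. blin_act y (aff_embed (\<rho> (inv_into U \<psi> p)))) has_derivative K) (at (\<psi> \<one>\<^bsub>G\<^esub>))"
      unfolding K_def
      by (rule has_derivative_compose) (simp add: inv_U[OF one] embed_one blin_act_has_derivative)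
    then show ?thesis
      by (rule has_derivative_transform_within_open[OF _ chart_facts(2)])
        (use one U_sub inv_U f_eq F_def in auto)
  qed
  then have linear_K: "linear K" by (rule has_derivative_linear)
  have "K (\<theta> X) = 0" by (simp add: K_def diff X)
  have "\<theta> X \<noteq> 0" using \<open>X \<noteq> 0\<close> \<theta>(2) linear_injective_0[OF \<theta>(1)] by blast
  \<comment> \<open>\<open>L\<close> gives the model space of the charts the coordinates of
    \<open>real^4\<close>, in which the kernel vector becomes a rank defect of a square
    matrix.\<close>
  have not_inj: "\<not> inj (K \<circ> L)"
  proof -
    obtain u where u: "L u = \<theta> X" using L(2) by (metis bij_pointE)
    then have "u \<noteq> 0" using \<open>\<theta> X \<noteq> 0\<close> linear_0[OF L(1)] by auto
    moreover have "(K \<circ> L) u = 0" using u \<open>K (\<theta> X) = 0\<close> by simp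
    ultimately show ?thesis
      using linear_injective_0[OF linear_compose[OF L(1) linear_K]] by blast
  qed
  have dim_K: "dim (range K) < 4"
  proof -
    have lin: "linear (K \<circ> L)" by (rule linear_compose[OF L(1) linear_K])
    have "rank (matrix (K \<circ> L)) < CARD(4)"
      using not_inj less_rank_noninjective[of "matrix (K \<circ> L)"] matrix_vector_mul(2)[OF lin] by simp
    moreover have "range ((*v) (matrix (K \<circ> L))) = range K"
      using matrix_vector_mul(2)[OF lin] L(2) by (metis bij_is_surj image_comp)
    ultimately show ?thesis by (simp add: rank_dim_range)
  qed
  \<comment> \<open>Near \<open>\<psi> b\<close> the map \<open>F\<close> factors as left
    translation by the inverse of \<open>b\<close>, then \<open>F\<close> near the identity, then
    the affine map of \<open>\<rho> b\<close>. The middle factor has derivative \<open>K\<close>,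
    which bounds the rank.\<close>
  have local: "\<exists>D. (F has_derivative D) (at (\<psi> b)) \<and> dim (range D) < 4" if b: "b \<in> U" for b
  proof -
    have bc: "b \<in> carrier G" using b U_sub by blast
    let ?b' = "inv\<^bsub>G\<^esub> b"
    let ?T = "\<lambda>p. \<psi> (?b' \<otimes>\<^bsub>G\<^esub> inv_into U \<psi> p)"
    let ?A = "\<lambda>x. aff_act ?H (\<rho> b) x"
    have T1: "?T (\<psi> b) = \<psi> \<one>\<^bsub>G\<^esub>" using inv_U[OF b] bc by simp
    obtain T' where T': "(?T has_derivative T') (at (\<psi> b))"
      using left_translation_differentiable[OF G chart inv_closed[OF bc] b] one bc
      unfolding differentiable_def by auto
    obtain A' where A': "(?A has_derivative A') (at (F (\<psi> \<one>\<^bsub>G\<^esub>)))"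
      using aff_act_differentiable[OF lin[OF bc], of "fst (\<rho> b)"] unfolding differentiable_def by auto
    have "((\<lambda>p. F (?T p)) has_derivative (\<lambda>v. K (T' v))) (at (\<psi> b))"
      using T' by (rule has_derivative_compose) (simp only: T1 DF)
    then have "((\<lambda>p. ?A (F (?T p))) has_derivative (\<lambda>v. A' (K (T' v)))) (at (\<psi> b))"
      by (rule has_derivative_compose) (simp only: T1 A')
    moreover
    let ?W = "{a \<in> carrier G. ?b' \<otimes>\<^bsub>G\<^esub> a \<in> U} \<inter> U"
    have "open (\<psi> ` ?W)"
      by (intro chart_facts(4) openin_Int openin_left_translate_preimage[OF G inv_closed[OF bc] chart_facts(3)]
          chart_facts(3)) auto
    moreover have "\<psi> b \<in> \<psi> ` ?W" using b bc one by auto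
    moreover have "?A (F (?T p)) = F p" if "p \<in> \<psi> ` ?W" for p
    proof -
      obtain a where a: "a \<in> U" "a \<in> carrier G" "?b' \<otimes>\<^bsub>G\<^esub> a \<in> U" "p = \<psi> a" using \<open>p \<in> \<psi> ` ?W\<close> by blast
      have "b \<otimes>\<^bsub>G\<^esub> (?b' \<otimes>\<^bsub>G\<^esub> a) = a" using a bc by (simp flip: m_assoc)
      then show ?thesis
        using f_mult[OF bc, of "?b' \<otimes>\<^bsub>G\<^esub> a"] a bc by (simp add: F_def inv_U)
    qed
    ultimately have "(F has_derivative (\<lambda>v. A' (K (T' v)))) (at (\<psi> b))"
      by (rule has_derivative_transform_within_open)
    moreover have "dim (range (\<lambda>v. A' (K (T' v)))) < 4"
    proof -
      have "range (\<lambda>v. A' (K (T' v))) \<subseteq> A' ` range K" by auto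
      then have "dim (range (\<lambda>v. A' (K (T' v)))) \<le> dim (A' ` range K)" by (rule dim_subset)
      also have "\<dots> \<le> dim (range K)"
        using A' by (intro dim_image_le has_derivative_linear)
      finally show ?thesis using dim_K by simp
    qed
    ultimately show ?thesis by blast
  qed
  have neg_U: "negligible (f ` U)"
  proof -
    let ?S = "L -` (\<psi> ` U)"
    have "\<forall>x\<in>?S. \<exists>D. (F has_derivative D) (at (L x)) \<and> dim (range D) < 4"
      using local by auto
    then obtain D where D: "\<And>x. x \<in> ?S \<Longrightarrow> (F has_derivative D x) (at (L x)) \<and> dim (range (D x)) < 4"
      by metis
    have "negligible ((\<lambda>x. F (L x)) ` ?S)"
    proof (rule baby_Sard[where f' = "\<lambda>x v. D x (L v)"])
      fix x assume x: "x \<in> ?S"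
      have d: "(F has_derivative D x) (at (L x))" and dim: "dim (range (D x)) < 4" using D[OF x] by auto
      have "((\<lambda>x. F (L x)) has_derivative (\<lambda>v. D x (L v))) (at x)"
      proof (rule has_derivative_compose[where f = L and f' = L, OF _ d])
        show "(L has_derivative L) (at x)"
          using L(1) by (simp add: linear_conv_bounded_linear bounded_linear_imp_has_derivative)
      qed
      then show "((\<lambda>x. F (L x)) has_derivative (\<lambda>v. D x (L v))) (at x within ?S)"
        by (rule has_derivative_at_withinI)
      have lin: "linear (\<lambda>v. D x (L v))"
        using linear_compose[OF L(1) has_derivative_linear[OF d]] by (simp add: comp_def)
      have "rank (matrix (\<lambda>v. D x (L v))) = dim (range (\<lambda>v. D x (L v)))"
        using matrix_vector_mul(2)[OF lin] by (simp add: rank_dim_range)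
      also have "\<dots> \<le> dim (range (D x))" by (rule dim_subset) auto
      finally show "rank (matrix (\<lambda>v. D x (L v))) < CARD(4)" using dim by simp
    qed simp
    moreover have "(\<lambda>x. F (L x)) ` ?S = f ` U"
    proof -
      have "L ` ?S = \<psi> ` U" using bij_is_surj[OF L(2)] by (rule surj_image_vimage_eq)
      then have "(\<lambda>x. F (L x)) ` ?S = F ` \<psi> ` U" by (metis image_image)
      also have "\<dots> = f ` U" unfolding image_image F_def by (rule image_cong) (simp_all add: inv_U)
      finally show ?thesis .
    qed
    ultimately show ?thesis by simp
  qed
  obtain A where A: "countable A" "A \<subseteq> carrier G" "carrier G \<subseteq> (\<Union>a\<in>A. (\<lambda>x. a \<otimes>\<^bsub>G\<^esub> x) ` U)"
    using countable_translates_cover[OF G chart_facts(3) one] by blast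
  have "negligible (\<Union>a\<in>A. f ` (\<lambda>x. a \<otimes>\<^bsub>G\<^esub> x) ` U)"
  proof (intro negligible_countable_Union)
    show "countable ((\<lambda>a. f ` (\<lambda>x. a \<otimes>\<^bsub>G\<^esub> x) ` U) ` A)" using A(1) by simp
    fix S assume "S \<in> (\<lambda>a. f ` (\<lambda>x. a \<otimes>\<^bsub>G\<^esub> x) ` U) ` A"
    then obtain a where a: "a \<in> carrier G" "S = f ` (\<lambda>x. a \<otimes>\<^bsub>G\<^esub> x) ` U" using A(2) by blast
    have "S = (\<lambda>x. aff_act ?H (\<rho> a) x) ` f ` U"
      unfolding a image_image using f_mult[OF a(1)] U_sub by (intro image_cong) auto
    moreover have "negligible ((\<lambda>x. aff_act ?H (\<rho> a) x) ` f ` U)"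
    proof (rule negligible_differentiable_image_negligible[OF _ neg_U])
      show "(\<lambda>x. aff_act ?H (\<rho> a) x) differentiable_on f ` U"
        using aff_act_differentiable[OF lin[OF a(1)], of "fst (\<rho> a)"]
        by (simp add: differentiable_on_def differentiable_at_withinI)
    qed simp
    ultimately show "negligible S" by simp
  qed
  moreover have "(\<Union>a\<in>A. f ` (\<lambda>x. a \<otimes>\<^bsub>G\<^esub> x) ` U) = UNIV"
  proof -
    have "z \<in> (\<Union>a\<in>A. f ` (\<lambda>x. a \<otimes>\<^bsub>G\<^esub> x) ` U)" for z
    proof -
      obtain b where "b \<in> carrier G" "f b = z" using trans[of y z] by (auto simp: f_def)
      then show ?thesis using A(3) by blast
    qed
    then show ?thesis by blast
  qed
  ultimately show False by simp
qed

section \<open>Derivations of \<open>n4\<close>\<close>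

text \<open>A derivation of \<open>n4\<close> is lower triangular, and is determined by the following entries.\<close>

definition cA :: "(real^4) \<Rightarrow>\<^sub>L (real^4) \<Rightarrow> real" where "cA D = D (ee 1) $ 1"
definition cB :: "(real^4) \<Rightarrow>\<^sub>L (real^4) \<Rightarrow> real" where "cB D = D (ee 1) $ 2"
definition cC :: "(real^4) \<Rightarrow>\<^sub>L (real^4) \<Rightarrow> real" where "cC D = D (ee 1) $ 3"
definition cD :: "(real^4) \<Rightarrow>\<^sub>L (real^4) \<Rightarrow> real" where "cD D = D (ee 1) $ 4"
definition cE :: "(real^4) \<Rightarrow>\<^sub>L (real^4) \<Rightarrow> real" where "cE D = D (ee 2) $ 2"
definition cK :: "(real^4) \<Rightarrow>\<^sub>L (real^4) \<Rightarrow> real" where "cK D = D (ee 2) $ 3"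
definition cL :: "(real^4) \<Rightarrow>\<^sub>L (real^4) \<Rightarrow> real" where "cL D = D (ee 2) $ 4"

lemmas coord_defs = cA_def cB_def cC_def cD_def cE_def cK_def cL_def

lemma coord_scale:
  "cA (r *\<^sub>R D) = r * cA D" "cB (r *\<^sub>R D) = r * cB D" "cC (r *\<^sub>R D) = r * cC D" "cD (r *\<^sub>R D) = r * cD D"
  "cE (r *\<^sub>R D) = r * cE D" "cK (r *\<^sub>R D) = r * cK D" "cL (r *\<^sub>R D) = r * cL D"
  by (simp_all add: coord_defs blinfun.scaleR_left)

lemma coord_add:
  "cA (D + E) = cA D + cA E" "cB (D + E) = cB D + cB E" "cC (D + E) = cC D + cC E" "cD (D + E) = cD D + cD E"
  "cE (D + E) = cE D + cE E" "cK (D + E) = cK D + cK E" "cL (D + E) = cL D + cL E"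
  by (simp_all add: coord_defs blinfun.add_left)

lemma coord_diff:
  "cA (D - E) = cA D - cA E" "cB (D - E) = cB D - cB E" "cC (D - E) = cC D - cC E" "cD (D - E) = cD D - cD E"
  "cE (D - E) = cE D - cE E" "cK (D - E) = cK D - cK E" "cL (D - E) = cL D - cL E"
  by (simp_all add: coord_defs blinfun.diff_left)

text \<open>The vectors \<open>ee 1\<close> and \<open>ee 2\<close> generate \<open>n4\<close>, so
  the Leibniz rule computes the images of \<open>ee 3\<close> and \<open>ee 4\<close> from
  theirs.\<close>

lemma derivation_n4_nth:
  assumes "derivation n4 D"
  shows "D z $ 1 = cA D * z $ 1"
    "D z $ 2 = cB D * z $ 1 + cE D * z $ 2"
    "D z $ 3 = cC D * z $ 1 + cK D * z $ 2 + (cA D + cE D) * z $ 3"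
    "D z $ 4 = cD D * z $ 1 + cL D * z $ 2 + cK D * z $ 3 + (2 * cA D + cE D) * z $ 4"
proof -
  have der: "D (n4 x y) = n4 (D x) y + n4 x (D y)" for x y
    using assms by (simp add: derivation_def)
  have e: "n4 (ee 1) (ee 2) = ee 3" "n4 (ee 1) (ee 3) = ee 4" "n4 (ee 2) (ee 3) = 0"
    by (simp_all add: vec_eq_iff forall_4 axis_def)
  have d3: "D (ee 3) = n4 (D (ee 1)) (ee 2) + n4 (ee 1) (D (ee 2))"
    and d4: "D (ee 4) = n4 (D (ee 1)) (ee 3) + n4 (ee 1) (D (ee 3))"
    and d0: "0 = n4 (D (ee 2)) (ee 3) + n4 (ee 2) (D (ee 3))"
    using der[of "ee 1" "ee 2"] der[of "ee 1" "ee 3"] der[of "ee 2" "ee 3"] by (simp_all add: e)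
  have n3: "D (ee 3) $ 1 = 0" "D (ee 3) $ 2 = 0" "D (ee 3) $ 3 = cA D + cE D" "D (ee 3) $ 4 = cK D"
    using d3 by (simp_all add: coord_defs axis_def)
  have n4: "D (ee 4) $ 1 = 0" "D (ee 4) $ 2 = 0" "D (ee 4) $ 3 = 0" "D (ee 4) $ 4 = 2 * cA D + cE D"
    using d4 n3 by (simp_all add: coord_defs axis_def)
  \<comment> \<open>The \<open>ee 4\<close> coordinate of the Leibniz rule for
    \<open>[e_2, e_3] = 0\<close> is exactly \<open>D (ee 2) $ 1\<close>; this relation makes
    \<open>D\<close> triangular.\<close>
  have "(0 :: real^4) $ 4 = (n4 (D (ee 2)) (ee 3) + n4 (ee 2) (D (ee 3))) $ 4" using d0 by simp
  then have n2: "D (ee 2) $ 1 = 0"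
    using n3 by (simp add: axis_def)
  have "z = z $ 1 *\<^sub>R ee 1 + z $ 2 *\<^sub>R ee 2 + z $ 3 *\<^sub>R ee 3 + z $ 4 *\<^sub>R ee 4"
    by (simp add: vec_eq_iff forall_4 axis_def)
  from arg_cong[OF this, of D] have "D z = z $ 1 *\<^sub>R D (ee 1) + z $ 2 *\<^sub>R D (ee 2) + z $ 3 *\<^sub>R D (ee 3) + z $ 4 *\<^sub>R D (ee 4)"
    by (simp only: blinfun.add_right blinfun.scaleR_right)
  then show "D z $ 1 = cA D * z $ 1"
    "D z $ 2 = cB D * z $ 1 + cE D * z $ 2"
    "D z $ 3 = cC D * z $ 1 + cK D * z $ 2 + (cA D + cE D) * z $ 3"
    "D z $ 4 = cD D * z $ 1 + cL D * z $ 2 + cK D * z $ 3 + (2 * cA D + cE D) * z $ 4"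
    by (simp_all add: n2 n3 n4 coord_defs)
qed

text \<open>In this order of the coordinates each right-hand side involves only the same coordinate
  of \<open>(s, E)\<close> and earlier ones. So the bracket with \<open>(t, D)\<close> is
  triangular, with diagonal \<open>0, 0, e - a, a, e, 2 a, a + e\<close> on derivations and
  \<open>a, e, a + e, 2 a + e\<close> on translations, where \<open>a = cA D\<close> and
  \<open>e = cE D\<close>. The eigenvector arguments below eliminate the coordinates one by
  one.\<close>

lemma aff_morphism_coords:
  assumes \<phi>: "aff_morphism b n4 \<phi>" and X: "\<phi> X = (t, D)" and Z: "\<phi> Z = (s, E)" and W: "\<phi> (b X Z) = (r, R)"
  shows "cA R = 0" "cE R = 0"
    "cB R = (cE D - cA D) * cB E + cB D * (cA E - cE E)"
    "cK R = cA D * cK E - cK D * cA E"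
    "cC R = cE D * cC E - cC D * cE E + cK D * cB E - cB D * cK E"
    "cL R = 2 * cA D * cL E - 2 * cL D * cA E"
    "cD R = (cA D + cE D) * cD E - cD D * (cA E + cE E) + cL D * cB E + cK D * cC E
       - cB D * cL E - cC D * cK E"
    "r $ 1 = cA D * s $ 1 - cA E * t $ 1"
    "r $ 2 = cE D * s $ 2 + cB D * s $ 1 - cB E * t $ 1 - cE E * t $ 2"
    "r $ 3 = (cA D + cE D) * s $ 3 + t $ 1 * s $ 2 - t $ 2 * s $ 1 + cC D * s $ 1 + cK D * s $ 2
       - cC E * t $ 1 - cK E * t $ 2 - (cA E + cE E) * t $ 3"
    "r $ 4 = (2 * cA D + cE D) * s $ 4 + t $ 1 * s $ 3 - t $ 3 * s $ 1 + cD D * s $ 1 + cL D * s $ 2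
       + cK D * s $ 3 - cD E * t $ 1 - cL E * t $ 2 - cK E * t $ 3 - (2 * cA E + cE E) * t $ 4"
proof -
  have D: "derivation n4 D" and E: "derivation n4 E"
    using \<phi>[unfolded aff_morphism_def, THEN conjunct2, THEN conjunct1, rule_format, of X]
      \<phi>[unfolded aff_morphism_def, THEN conjunct2, THEN conjunct1, rule_format, of Z]
    by (simp_all add: X Z)
  have "\<phi> (b X Z) = aff_bracket n4 (\<phi> X) (\<phi> Z)"
    using \<phi> by (simp add: aff_morphism_def)
  then have r: "r = n4 t s + D s - E t" and R: "R = (D o\<^sub>L E) - (E o\<^sub>L D)"
    by (simp_all add: X Z W aff_bracket_def)
  note nth = derivation_n4_nth[OF D] derivation_n4_nth[OF E]
  show "r $ 1 = cA D * s $ 1 - cA E * t $ 1"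
    "r $ 2 = cE D * s $ 2 + cB D * s $ 1 - cB E * t $ 1 - cE E * t $ 2"
    "r $ 3 = (cA D + cE D) * s $ 3 + t $ 1 * s $ 2 - t $ 2 * s $ 1 + cC D * s $ 1 + cK D * s $ 2
       - cC E * t $ 1 - cK E * t $ 2 - (cA E + cE E) * t $ 3"
    "r $ 4 = (2 * cA D + cE D) * s $ 4 + t $ 1 * s $ 3 - t $ 3 * s $ 1 + cD D * s $ 1 + cL D * s $ 2
       + cK D * s $ 3 - cD E * t $ 1 - cL E * t $ 2 - cK E * t $ 3 - (2 * cA E + cE E) * t $ 4"
    unfolding r by (simp_all add: nth)
  have "R (ee 1) = D (E (ee 1)) - E (D (ee 1))" "R (ee 2) = D (E (ee 2)) - E (D (ee 2))"
    by (simp_all add: R blinfun.diff_left)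
  note R = this
  have ax: "ee 1 $ 1 = 1" "ee 1 $ 2 = 0" "ee 1 $ 3 = 0" "ee 1 $ 4 = 0"
    "ee 2 $ 1 = 0" "ee 2 $ 2 = 1" "ee 2 $ 3 = 0" "ee 2 $ 4 = 0"
    by (simp_all add: axis_def)
  note R' = R[unfolded vec_eq_iff forall_4 vector_minus_component nth]
  show "cA R = 0" "cE R = 0"
    "cB R = (cE D - cA D) * cB E + cB D * (cA E - cE E)"
    "cK R = cA D * cK E - cK D * cA E"
    "cC R = cE D * cC E - cC D * cE E + cK D * cB E - cB D * cK E"
    "cL R = 2 * cA D * cL E - 2 * cL D * cA E"
    "cD R = (cA D + cE D) * cD E - cD D * (cA E + cE E) + cL D * cB E + cK D * cC E
       - cB D * cL E - cC D * cK E"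
    unfolding cA_def[of R] cB_def[of R] cC_def[of R] cD_def[of R] cE_def[of R] cK_def[of R] cL_def[of R]
    by (simp_all add: R' ax algebra_simps)
qed

text \<open>The equations make \<open>(p, q)\<close> an eigenvector, for the real value
  \<open>m\<close>, of a matrix with eigenvalues \<nu> + i and \<nu> - i; its characteristic
  polynomial at \<open>m\<close> is \<open>1 + (m - \<nu>)\<^sup>2\<close>.\<close>

lemma no_real_complex_eigenvalue:
  fixes m :: real
  assumes "m * p = \<nu> * p - q" "m * q = p + \<nu> * q"
  shows "p = 0" "q = 0"
proof -
  have "(1 + (m - \<nu>)\<^sup>2) * p = 0"
    using assms by algebra
  moreover have "1 + (m - \<nu>)\<^sup>2 \<noteq> 0"
    using zero_le_power2[of "m - \<nu>"] by linarith
  ultimately show "p = 0" by simp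
  with assms(1) show "q = 0" by simp
qed

text \<open>Since derivations of \<open>n4\<close> are triangular, \<open>ad (\<phi> X)\<close> has only real eigenvalues.\<close>

lemma complex_pair_translation_zero:
  assumes \<phi>: "aff_morphism b n4 \<phi>"
    and b: "b X Z = \<nu> *\<^sub>R Z - Y" "b X Y = Z + \<nu> *\<^sub>R Y"
  shows "fst (\<phi> Z) = 0"
proof -
  have lin: "linear \<phi>" using \<phi> by (simp add: aff_morphism_def)
  obtain t D s E r R where X: "\<phi> X = (t, D)" and Z: "\<phi> Z = (s, E)" and Y: "\<phi> Y = (r, R)"
    by (metis surj_pair)
  have "\<phi> (b X Z) = (\<nu> *\<^sub>R s - r, \<nu> *\<^sub>R E - R)" "\<phi> (b X Y) = (s + \<nu> *\<^sub>R r, E + \<nu> *\<^sub>R R)"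
    by (simp_all add: b linear_diff[OF lin] linear_add[OF lin] linear_scale[OF lin] Z Y)
  \<comment> \<open>Facts 1 to 11 are the coordinates of the equation for \<open>Z\<close>, facts 12
    to 22 those for \<open>Y\<close>; fact k and fact k + 11 together form one system for
    \<open>no_real_complex_eigenvalue\<close>.\<close>
  note c = aff_morphism_coords[OF \<phi> X Z this(1)] aff_morphism_coords[OF \<phi> X Y this(2)]
  note c = c[unfolded coord_diff coord_add coord_scale vector_minus_component vector_add_component
      vector_scaleR_component real_scaleR_def]
  have A: "cA E = 0" "cA R = 0"
    using no_real_complex_eigenvalue[of 0 "cA E" \<nu> "cA R"] c(1,12) by simp_all
  have E: "cE E = 0" "cE R = 0"
    using no_real_complex_eigenvalue[of 0 "cE E" \<nu> "cE R"] c(2,13) by simp_all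
  have B: "cB E = 0" "cB R = 0"
    using no_real_complex_eigenvalue[of "cE D - cA D" "cB E" \<nu> "cB R"] c(3,14)
    unfolding A E by simp_all
  have K: "cK E = 0" "cK R = 0"
    using no_real_complex_eigenvalue[of "cA D" "cK E" \<nu> "cK R"] c(4,15)
    unfolding A E by simp_all
  have C: "cC E = 0" "cC R = 0"
    using no_real_complex_eigenvalue[of "cE D" "cC E" \<nu> "cC R"] c(5,16)
    unfolding A E B K by simp_all
  have L: "cL E = 0" "cL R = 0"
    using no_real_complex_eigenvalue[of "2 * cA D" "cL E" \<nu> "cL R"] c(6,17)
    unfolding A E by simp_all
  have DD: "cD E = 0" "cD R = 0"
    using no_real_complex_eigenvalue[of "cA D + cE D" "cD E" \<nu> "cD R"] c(7,18)
    unfolding A E B C K L by simp_all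
  have s1: "s $ 1 = 0" "r $ 1 = 0"
    using no_real_complex_eigenvalue[of "cA D" "s $ 1" \<nu> "r $ 1"] c(8,19)
    unfolding A E by simp_all
  have s2: "s $ 2 = 0" "r $ 2 = 0"
    using no_real_complex_eigenvalue[of "cE D" "s $ 2" \<nu> "r $ 2"] c(9,20)
    unfolding A E B s1 by simp_all
  have s3: "s $ 3 = 0" "r $ 3 = 0"
    using no_real_complex_eigenvalue[of "cA D + cE D" "s $ 3" \<nu> "r $ 3"] c(10,21)
    unfolding A E C K s1 s2 by simp_all
  have s4: "s $ 4 = 0" "r $ 4 = 0"
    using no_real_complex_eigenvalue[of "2 * cA D + cE D" "s $ 4" \<nu> "r $ 4"] c(11,22)
    unfolding A E DD K L s1 s2 s3 by simp_all
  show ?thesis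
    using s1 s2 s3 s4 by (simp add: Z vec_eq_iff forall_4)
qed

text \<open>The hypotheses give \<open>x * x * y = 0\<close>. Here \<open>x\<close> will be a weight
  minus the eigenvalue and \<open>s\<close> the contribution of the nilpotent part: when
  \<open>x\<close> kills \<open>s\<close> too, a generalized eigenvector equation becomes a genuine
  one.\<close>

lemma eigen_step:
  fixes x y s :: real
  assumes "x * y = s" "x * s = 0"
  shows "x * y = 0"
  using assms by auto

text \<open>Here \<open>D\<close> commutes with its semisimple part and the translation part is killed by it, so
  \<open>ad (t, D)\<close> differs from the semisimple part by a commuting nilpotent map. Hence its
  eigenvectors are eigenvectors of the semisimple part.\<close>

lemma eigenvector_weights:
  assumes \<phi>: "aff_morphism b n4 \<phi>" and X: "\<phi> X = (t, D)" and Z: "\<phi> Z = (s, E)"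
    and b: "b X Z = \<kappa> *\<^sub>R Z" and w: "a = cA D" "e = cE D"
    and N: "a * cK D = 0" "a * cL D = 0" "(e - a) * cB D = 0" "e * cC D = 0" "(a + e) * cD D = 0"
    and T: "a * t $ 1 = 0" "e * t $ 2 = 0" "(a + e) * t $ 3 = 0" "(2 * a + e) * t $ 4 = 0"
  shows "(a - \<kappa>) * s $ 1 = 0" "(e - \<kappa>) * s $ 2 = 0" "(a + e - \<kappa>) * s $ 3 = 0"
    "(2 * a + e - \<kappa>) * s $ 4 = 0"
proof -
  have "linear \<phi>" using \<phi> by (simp add: aff_morphism_def)
  then have "\<phi> (b X Z) = (\<kappa> *\<^sub>R s, \<kappa> *\<^sub>R E)"
    by (simp add: b linear_scale Z)
  note c = aff_morphism_coords[OF \<phi> X Z this, folded w]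
  note c = c[unfolded coord_scale vector_scaleR_component real_scaleR_def]
  have A: "\<kappa> * cA E = 0" and EE: "\<kappa> * cE E = 0"
    using c(1,2) by simp_all
  have B: "(e - a - \<kappa>) * cB E = 0"
  proof (rule eigen_step)
    show "(e - a - \<kappa>) * cB E = cB D * (cE E - cA E)" using c(3) by (simp add: algebra_simps)
    show "(e - a - \<kappa>) * (cB D * (cE E - cA E)) = 0" using A EE N by algebra
  qed
  have K: "(a - \<kappa>) * cK E = 0"
  proof (rule eigen_step)
    show "(a - \<kappa>) * cK E = cK D * cA E" using c(4) by (simp add: algebra_simps)
    show "(a - \<kappa>) * (cK D * cA E) = 0" using A N by algebra
  qed
  \<comment> \<open>A nonzero nilpotent entry forces an equality of weights. Under it the factor of
    the current coordinate equals that of the earlier coordinate multiplied by the entry, so every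
    mixed term below is killed.\<close>
  have k: "cK D = 0 \<or> a = 0" and l: "cL D = 0 \<or> a = 0" and bb: "cB D = 0 \<or> e = a"
    and cc: "cC D = 0 \<or> e = 0" and d: "cD D = 0 \<or> e = - a"
    using N(1) N(2) N(3) N(4) N(5) by (simp_all add: disj_commute add_eq_0_iff)
  have t1: "t $ 1 = 0 \<or> a = 0" and t2: "t $ 2 = 0 \<or> e = 0" and t3: "t $ 3 = 0 \<or> e = - a"
    using T(1) T(2) T(3) by (simp_all add: disj_commute add_eq_0_iff)
  have C: "(e - \<kappa>) * cC E = 0"
  proof (rule eigen_step)
    show "(e - \<kappa>) * cC E = cC D * cE E - cK D * cB E + cB D * cK E" using c(5) by (simp add: algebra_simps)
    have "(e - \<kappa>) * (cC D * cE E) = 0" using EE N by algebra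
    moreover have "(e - \<kappa>) * (cK D * cB E) = 0" using k B by auto
    moreover have "(e - \<kappa>) * (cB D * cK E) = 0" using bb K by auto
    ultimately show "(e - \<kappa>) * (cC D * cE E - cK D * cB E + cB D * cK E) = 0"
      unfolding distrib_left right_diff_distrib by linarith
  qed
  have L: "(2 * a - \<kappa>) * cL E = 0"
  proof (rule eigen_step)
    show "(2 * a - \<kappa>) * cL E = 2 * cL D * cA E" using c(6) by (simp add: algebra_simps)
    show "(2 * a - \<kappa>) * (2 * cL D * cA E) = 0" using A N by algebra
  qed
  have DD: "(a + e - \<kappa>) * cD E = 0"
  proof (rule eigen_step)
    show "(a + e - \<kappa>) * cD E = cD D * (cA E + cE E) - cL D * cB E - cK D * cC E + cB D * cL E + cC D * cK E"
      using c(7) by (simp add: algebra_simps)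
    have "(a + e - \<kappa>) * (cD D * (cA E + cE E)) = 0" using A EE N by algebra
    moreover have "(a + e - \<kappa>) * (cL D * cB E) = 0" using l B by auto
    moreover have "(a + e - \<kappa>) * (cK D * cC E) = 0" using k C by auto
    moreover have "(a + e - \<kappa>) * (cB D * cL E) = 0" using bb L by auto
    moreover have "(a + e - \<kappa>) * (cC D * cK E) = 0" using cc K by auto
    ultimately show "(a + e - \<kappa>) * (cD D * (cA E + cE E) - cL D * cB E - cK D * cC E + cB D * cL E
        + cC D * cK E) = 0"
      unfolding distrib_left right_diff_distrib by linarith
  qed
  show s1: "(a - \<kappa>) * s $ 1 = 0"
  proof (rule eigen_step)
    show "(a - \<kappa>) * s $ 1 = cA E * t $ 1" using c(8) by (simp add: algebra_simps)
    show "(a - \<kappa>) * (cA E * t $ 1) = 0" using t1 A by auto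
  qed
  show s2: "(e - \<kappa>) * s $ 2 = 0"
  proof (rule eigen_step)
    show "(e - \<kappa>) * s $ 2 = cB E * t $ 1 + cE E * t $ 2 - cB D * s $ 1" using c(9) by (simp add: algebra_simps)
    have "(e - \<kappa>) * (cB D * s $ 1) = 0" using bb s1 by auto
    moreover have "(e - \<kappa>) * (cB E * t $ 1) = 0" using t1 B by auto
    moreover have "(e - \<kappa>) * (cE E * t $ 2) = 0" using t2 EE by auto
    ultimately show "(e - \<kappa>) * (cB E * t $ 1 + cE E * t $ 2 - cB D * s $ 1) = 0"
      unfolding distrib_left right_diff_distrib by linarith
  qed
  show s3: "(a + e - \<kappa>) * s $ 3 = 0"
  proof (rule eigen_step)
    show "(a + e - \<kappa>) * s $ 3 = t $ 2 * s $ 1 - t $ 1 * s $ 2 - cC D * s $ 1 - cK D * s $ 2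
       + cC E * t $ 1 + cK E * t $ 2 + (cA E + cE E) * t $ 3" using c(10) by (simp add: algebra_simps)
    have "(a + e - \<kappa>) * (t $ 2 * s $ 1) = 0" using t2 s1 by auto
    moreover have "(a + e - \<kappa>) * (t $ 1 * s $ 2) = 0" using t1 s2 by auto
    moreover have "(a + e - \<kappa>) * (cC D * s $ 1) = 0" using cc s1 by auto
    moreover have "(a + e - \<kappa>) * (cK D * s $ 2) = 0" using k s2 by auto
    moreover have "(a + e - \<kappa>) * (cC E * t $ 1) = 0" using t1 C by auto
    moreover have "(a + e - \<kappa>) * (cK E * t $ 2) = 0" using t2 K by auto
    moreover have "(a + e - \<kappa>) * ((cA E + cE E) * t $ 3) = 0" using A EE T(3) by algebra
    ultimately show "(a + e - \<kappa>) * (t $ 2 * s $ 1 - t $ 1 * s $ 2 - cC D * s $ 1 - cK D * s $ 2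
       + cC E * t $ 1 + cK E * t $ 2 + (cA E + cE E) * t $ 3) = 0"
      unfolding distrib_left right_diff_distrib by linarith
  qed
  show "(2 * a + e - \<kappa>) * s $ 4 = 0"
  proof (rule eigen_step)
    show "(2 * a + e - \<kappa>) * s $ 4 = t $ 3 * s $ 1 - t $ 1 * s $ 3 - cD D * s $ 1 - cL D * s $ 2
       - cK D * s $ 3 + cD E * t $ 1 + cL E * t $ 2 + cK E * t $ 3 + (2 * cA E + cE E) * t $ 4"
      using c(11) by (simp add: algebra_simps)
    have "(2 * a + e - \<kappa>) * (t $ 3 * s $ 1) = 0" using t3 s1 by auto
    moreover have "(2 * a + e - \<kappa>) * (t $ 1 * s $ 3) = 0" using t1 s3 by auto
    moreover have "(2 * a + e - \<kappa>) * (cD D * s $ 1) = 0" using d s1 by auto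
    moreover have "(2 * a + e - \<kappa>) * (cL D * s $ 2) = 0" using l s2 by auto
    moreover have "(2 * a + e - \<kappa>) * (cK D * s $ 3) = 0" using k s3 by auto
    moreover have "(2 * a + e - \<kappa>) * (cD E * t $ 1) = 0" using t1 DD by auto
    moreover have "(2 * a + e - \<kappa>) * (cL E * t $ 2) = 0" using t2 L by auto
    moreover have "(2 * a + e - \<kappa>) * (cK E * t $ 3) = 0" using t3 K by auto
    moreover have "(2 * a + e - \<kappa>) * ((2 * cA E + cE E) * t $ 4) = 0" using A EE T(4) by algebra
    ultimately show "(2 * a + e - \<kappa>) * (t $ 3 * s $ 1 - t $ 1 * s $ 3 - cD D * s $ 1 - cL D * s $ 2
       - cK D * s $ 3 + cD E * t $ 1 + cL E * t $ 2 + cK E * t $ 3 + (2 * cA E + cE E) * t $ 4) = 0"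
      unfolding distrib_left right_diff_distrib by linarith
  qed
qed

section \<open>Normal form of an element of \<open>aff n4\<close> up to conjugation\<close>

definition aff_conj ::
    "(real^4 \<Rightarrow> real^4) \<Rightarrow> (real^4 \<Rightarrow> real^4) \<Rightarrow> (real^4) \<times> ((real^4) \<Rightarrow>\<^sub>L (real^4)) \<Rightarrow>
      (real^4) \<times> ((real^4) \<Rightarrow>\<^sub>L (real^4))" where
  "aff_conj \<beta> \<gamma> T = (\<gamma> (fst T), Blinfun (\<lambda>z. \<gamma> (snd T (\<beta> z))))"

definition n4_auto :: "(real^4 \<Rightarrow> real^4) \<Rightarrow> (real^4 \<Rightarrow> real^4) \<Rightarrow> bool" where
  "n4_auto \<beta> \<gamma> \<longleftrightarrow> linear \<beta> \<and> linear \<gamma> \<and> (\<forall>z. \<beta> (\<gamma> z) = z) \<and> (\<forall>z. \<gamma> (\<beta> z) = z) \<and>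
     (\<forall>x y. \<beta> (n4 x y) = n4 (\<beta> x) (\<beta> y))"

lemma aff_conj_apply:
  assumes "n4_auto \<beta> \<gamma>"
  shows "fst (aff_conj \<beta> \<gamma> T) = \<gamma> (fst T)" "snd (aff_conj \<beta> \<gamma> T) z = \<gamma> (snd T (\<beta> z))"
proof -
  have l: "linear \<beta>" "linear \<gamma>" using assms by (simp_all add: n4_auto_def)
  have "linear (blinfun_apply (snd T))"
    by (rule bounded_linear.linear[OF blinfun.bounded_linear_right])
  then have "linear (\<lambda>z. \<gamma> (snd T (\<beta> z)))"
    using linear_compose[OF linear_compose[OF l(1)] l(2), of "blinfun_apply (snd T)"] by (simp add: comp_def)
  then show "fst (aff_conj \<beta> \<gamma> T) = \<gamma> (fst T)" "snd (aff_conj \<beta> \<gamma> T) z = \<gamma> (snd T (\<beta> z))"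
    by (simp_all add: aff_conj_def blinfun_apply_Blinfun)
qed

lemma n4_auto_inv_bracket:
  assumes "n4_auto \<beta> \<gamma>"
  shows "\<gamma> (n4 x y) = n4 (\<gamma> x) (\<gamma> y)"
proof -
  have "\<beta> (n4 (\<gamma> x) (\<gamma> y)) = n4 x y" and inv: "\<gamma> (\<beta> z) = z" for z
    using assms by (simp_all add: n4_auto_def)
  from arg_cong[OF this(1), of \<gamma>] show ?thesis by (simp add: inv)
qed

lemma aff_morphism_aff_conj:
  assumes \<phi>: "aff_morphism b n4 \<phi>" and auto: "n4_auto \<beta> \<gamma>"
  shows "aff_morphism b n4 (\<lambda>X. aff_conj \<beta> \<gamma> (\<phi> X))"
proof -
  have lin: "linear \<phi>" and der: "\<And>X. derivation n4 (snd (\<phi> X))"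
    and br: "\<And>X Y. \<phi> (b X Y) = aff_bracket n4 (\<phi> X) (\<phi> Y)"
    using \<phi> by (simp_all add: aff_morphism_def)
  have l: "linear \<gamma>" and inv: "\<And>z. \<beta> (\<gamma> z) = z" and hom: "\<And>x y. \<beta> (n4 x y) = n4 (\<beta> x) (\<beta> y)"
    using auto by (simp_all add: n4_auto_def)
  note hom' = n4_auto_inv_bracket[OF auto] and app = aff_conj_apply[OF auto]
  note lin_\<gamma> = linear_add[OF l] linear_diff[OF l] linear_scale[OF l]
  show ?thesis
    unfolding aff_morphism_def
  proof (intro conjI allI)
    show "linear (\<lambda>X. aff_conj \<beta> \<gamma> (\<phi> X))"
      by (rule linearI; rule prod_eqI; (rule blinfun_eqI)?;
          simp add: app lin_\<gamma> linear_add[OF lin] linear_scale[OF lin] blinfun.add_left blinfun.scaleR_left)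
    show "derivation n4 (snd (aff_conj \<beta> \<gamma> (\<phi> X)))" for X
      using der[of X] unfolding derivation_def app by (simp add: hom lin_\<gamma> hom' auto[unfolded n4_auto_def])
    show "aff_conj \<beta> \<gamma> (\<phi> (b X Y)) = aff_bracket n4 (aff_conj \<beta> \<gamma> (\<phi> X)) (aff_conj \<beta> \<gamma> (\<phi> Y))" for X Y
    proof (rule prod_eqI)
      show "fst (aff_conj \<beta> \<gamma> (\<phi> (b X Y))) = fst (aff_bracket n4 (aff_conj \<beta> \<gamma> (\<phi> X)) (aff_conj \<beta> \<gamma> (\<phi> Y)))"
        by (simp add: app br aff_bracket_def case_prod_beta lin_\<gamma> hom' inv)
      show "snd (aff_conj \<beta> \<gamma> (\<phi> (b X Y))) = snd (aff_bracket n4 (aff_conj \<beta> \<gamma> (\<phi> X)) (aff_conj \<beta> \<gamma> (\<phi> Y)))"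
        by (rule blinfun_eqI) (simp add: app br aff_bracket_def case_prod_beta lin_\<gamma> inv blinfun.diff_left)
    qed
  qed
qed

text \<open>Conjugation carries vector fields to vector fields, so zeros only move from
  \<open>\<beta> y\<close> to \<open>y\<close>, and a zero-free action stays zero-free.\<close>

lemma aff_velocity_aff_conj:
  assumes "n4_auto \<beta> \<gamma>"
  shows "aff_velocity y (aff_conj \<beta> \<gamma> T) = \<gamma> (aff_velocity (\<beta> y) T)"
proof -
  have l: "linear \<gamma>" and inv: "\<And>z. \<gamma> (\<beta> z) = z"
    using assms by (simp_all add: n4_auto_def)
  show ?thesis
    by (simp add: aff_velocity_def aff_conj_apply[OF assms] n4_auto_inv_bracket[OF assms] inv
        linear_add[OF l] linear_scale[OF l])
qed

text \<open>The translation part of the conjugate of \<open>(t, D)\<close> by the translation by \<open>v\<close>,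
  namely \<open>exp (ad v) (t, D)\<close>, where \<open>[v, (t, D)] = [v, t] - D v\<close>; the derivation part does not
  change.\<close>

definition aff_transl :: "real^4 \<Rightarrow> (real^4) \<times> ((real^4) \<Rightarrow>\<^sub>L (real^4)) \<Rightarrow> real^4" where
  "aff_transl v T = (let u = n4 v (fst T) - snd T v in
     fst T + u + (1/2) *\<^sub>R n4 v u + (1/6) *\<^sub>R n4 v (n4 v u))"

lemma aff_transl_nth:
  assumes "derivation n4 D"
  shows "aff_transl v (t, D) $ 1 = t $ 1 - cA D * v $ 1"
    "aff_transl v (t, D) $ 2 = t $ 2 - cB D * v $ 1 - cE D * v $ 2"
    "aff_transl v (t, D) $ 3 = t $ 3 + (v $ 1 * t $ 2 - v $ 2 * t $ 1)
       - cC D * v $ 1 - cK D * v $ 2 - (cA D + cE D) * v $ 3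
       + (v $ 2 * cA D * v $ 1 - v $ 1 * (cB D * v $ 1 + cE D * v $ 2)) / 2"
    "aff_transl v (t, D) $ 4 = t $ 4 + (v $ 1 * t $ 3 - v $ 3 * t $ 1)
       - cD D * v $ 1 - cL D * v $ 2 - cK D * v $ 3 - (2 * cA D + cE D) * v $ 4
       + (v $ 1 * (v $ 1 * t $ 2 - v $ 2 * t $ 1 - cC D * v $ 1 - cK D * v $ 2 - (cA D + cE D) * v $ 3)
          + v $ 3 * cA D * v $ 1) / 2
       + v $ 1 * (v $ 2 * cA D * v $ 1 - v $ 1 * (cB D * v $ 1 + cE D * v $ 2)) / 6"
  by (simp_all add: aff_transl_def Let_def derivation_n4_nth[OF assms] algebra_simps
      add_divide_distrib diff_divide_distrib)

text \<open>\<open>exp (ad v)\<close> preserves brackets. The bracket identity for the truncated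
  series is verified coordinatewise.\<close>

lemma aff_morphism_aff_transl:
  assumes \<phi>: "aff_morphism b n4 \<phi>"
  shows "aff_morphism b n4 (\<lambda>X. (aff_transl v (\<phi> X), snd (\<phi> X)))"
proof -
  interpret n4: bounded_bilinear n4 by (rule bounded_bilinear_n4)
  have lin: "linear \<phi>" and der: "\<And>X. derivation n4 (snd (\<phi> X))"
    and br: "\<And>X Y. \<phi> (b X Y) = aff_bracket n4 (\<phi> X) (\<phi> Y)"
    using \<phi> by (simp_all add: aff_morphism_def)
  show ?thesis
    unfolding aff_morphism_def
  proof (intro conjI allI)
    show "linear (\<lambda>X. (aff_transl v (\<phi> X), snd (\<phi> X)))"
      by (rule linearI; rule prod_eqI)
        (simp_all add: aff_transl_def Let_def linear_add[OF lin] linear_scale[OF lin] n4.add_right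
          n4.diff_right n4.scaleR_right blinfun.add_left blinfun.scaleR_left algebra_simps)
    show "derivation n4 (snd (aff_transl v (\<phi> X), snd (\<phi> X)))" for X
      using der by simp
    show "(aff_transl v (\<phi> (b X Y)), snd (\<phi> (b X Y))) =
      aff_bracket n4 (aff_transl v (\<phi> X), snd (\<phi> X)) (aff_transl v (\<phi> Y), snd (\<phi> Y))" for X Y
    proof -
      obtain t D s E r R where X: "\<phi> X = (t, D)" and Y: "\<phi> Y = (s, E)" and W: "\<phi> (b X Y) = (r, R)"
        by (metis surj_pair)
      have D: "derivation n4 D" and E: "derivation n4 E" and R: "derivation n4 R"
        using der[of X] der[of Y] der[of "b X Y"] by (simp_all add: X Y W)
      have eq: "r = n4 t s + D s - E t" "R = (D o\<^sub>L E) - (E o\<^sub>L D)"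
        using br[of X Y] by (simp_all add: X Y W aff_bracket_def)
      have "aff_transl v (r, R) = n4 (aff_transl v (t, D)) (aff_transl v (s, E))
          + D (aff_transl v (s, E)) - E (aff_transl v (t, D))"
        unfolding vec_eq_iff forall_4 vector_add_component vector_minus_component n4_nth
          derivation_n4_nth[OF D] derivation_n4_nth[OF E]
          aff_transl_nth[OF D] aff_transl_nth[OF E] aff_transl_nth[OF R]
          aff_morphism_coords[OF \<phi> X Y W]
        by (intro conjI; simp add: algebra_simps add_divide_distrib diff_divide_distrib)
      then show ?thesis
        using eq(2) by (simp add: X Y W aff_bracket_def)
    qed
  qed
qed

text \<open>Translation by \<open>v\<close> moves the point \<open>- v\<close> to \<open>0\<close>,
  where the velocity is the translation part. The two vectors differ by the operator
  \<open>1 - x/2 + x^2/12\<close> with \<open>x = ad v\<close>: the series of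
  \<open>x / (exp x - 1)\<close>, cut off by nilpotency.\<close>

lemma aff_velocity_eq_0_if_aff_transl:
  assumes "aff_transl v T = 0"
  shows "aff_velocity (- v) T = 0"
proof -
  interpret n4: bounded_bilinear n4 by (rule bounded_bilinear_n4)
  have nil: "n4 v (n4 v (n4 v x)) = 0" for x by (rule n4_nilpotent)
  have flip: "n4 x v = - n4 v x" for x by (simp add: vec_eq_iff forall_4)
  define u where "u = n4 v (fst T) - snd T v"
  have "aff_velocity (- v) T = aff_transl v T - (1/2) *\<^sub>R n4 v (aff_transl v T)
      + (1/12) *\<^sub>R n4 v (n4 v (aff_transl v T))"
    unfolding aff_velocity_def aff_transl_def Let_def u_def[symmetric]
    by (simp add: n4.add_right n4.scaleR_right n4.minus_left n4.minus_right nil flip blinfun.minus_right,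
        simp add: u_def n4.diff_right algebra_simps nil flip: scaleR_add_left)
  then show ?thesis by (simp add: assms n4.zero_right)
qed

lemma solve_linear_or_zero: "\<exists>x::real. c * (d + c * x) = 0"
  \<comment> \<open>for \<open>c = 0\<close> the witness is the junk value \<open>0\<close>\<close>
  by (rule exI[of _ "- d / c"]) simp

text \<open>Conjugation by a unipotent automorphism adds to each entry a free parameter times the
  difference of the weights that the entry links. If this difference is nonzero the entry can be
  removed; if it is zero the product vanishes anyway. The entries next to the diagonal come before
  those that depend on their parameters.\<close>

lemma normalize_derivation:
  assumes D: "derivation n4 D"
  obtains \<beta> \<gamma> where "n4_auto \<beta> \<gamma>"
    "\<And>t D'. aff_conj \<beta> \<gamma> (t, D) = (\<gamma> t, D') \<Longrightarrow> cA D' = cA D \<and> cE D' = cE D \<and>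
       cA D * cK D' = 0 \<and> cA D * cL D' = 0 \<and> (cE D - cA D) * cB D' = 0 \<and> cE D * cC D' = 0 \<and>
       (cA D + cE D) * cD D' = 0"
proof -
  obtain s where s: "cA D * (cK D + cA D * s) = 0" using solve_linear_or_zero by blast
  define k where "k = cK D + cA D * s"
  obtain p where p: "(cE D - cA D) * (cB D + (cE D - cA D) * p) = 0" using solve_linear_or_zero by blast
  define b where "b = cB D + (cE D - cA D) * p"
  \<comment> \<open>The weights of \<open>e_4\<close> and \<open>e_2\<close> differ by
    \<open>2 * cA D\<close>; the entry \<open>u / 2\<close> of \<beta> absorbs the factor 2.\<close>
  obtain u where u: "cA D * ((cL D + s * cK D - k * s) + cA D * u) = 0" using solve_linear_or_zero by blast
  obtain q where q: "cE D * ((cC D + p * cK D - b * s) + cE D * q) = 0" using solve_linear_or_zero by blast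
  define c where "c = (cC D + p * cK D - b * s) + cE D * q"
  obtain r where r: "(cA D + cE D) * ((cD D + p * cL D + q * cK D - b * (u / 2) - c * s) + (cA D + cE D) * r) = 0"
    using solve_linear_or_zero by blast
  define \<beta> :: "real^4 \<Rightarrow> real^4" where
    "\<beta> z = vector [z $ 1, p * z $ 1 + z $ 2, q * z $ 1 + s * z $ 2 + z $ 3,
       r * z $ 1 + (u / 2) * z $ 2 + s * z $ 3 + z $ 4]" for z
  define \<gamma> :: "real^4 \<Rightarrow> real^4" where
    "\<gamma> z = vector [z $ 1, z $ 2 - p * z $ 1, z $ 3 - q * z $ 1 - s * (z $ 2 - p * z $ 1),
       z $ 4 - r * z $ 1 - (u / 2) * (z $ 2 - p * z $ 1)
         - s * (z $ 3 - q * z $ 1 - s * (z $ 2 - p * z $ 1))]" for z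
  have \<beta>: "\<beta> z $ 1 = z $ 1" "\<beta> z $ 2 = p * z $ 1 + z $ 2" "\<beta> z $ 3 = q * z $ 1 + s * z $ 2 + z $ 3"
    "\<beta> z $ 4 = r * z $ 1 + (u / 2) * z $ 2 + s * z $ 3 + z $ 4" for z
    by (simp_all add: \<beta>_def)
  have \<gamma>: "\<gamma> z $ 1 = z $ 1" "\<gamma> z $ 2 = z $ 2 - p * z $ 1"
    "\<gamma> z $ 3 = z $ 3 - q * z $ 1 - s * (z $ 2 - p * z $ 1)"
    "\<gamma> z $ 4 = z $ 4 - r * z $ 1 - (u / 2) * (z $ 2 - p * z $ 1)
         - s * (z $ 3 - q * z $ 1 - s * (z $ 2 - p * z $ 1))" for z
    by (simp_all add: \<gamma>_def)
  have auto: "n4_auto \<beta> \<gamma>"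
    unfolding n4_auto_def
  proof (intro conjI allI)
    show "linear \<beta>" "linear \<gamma>"
      by (rule linearI; simp add: vec_eq_iff forall_4 \<beta> \<gamma> algebra_simps)+
    show "\<beta> (\<gamma> z) = z" "\<gamma> (\<beta> z) = z" "\<beta> (n4 x y) = n4 (\<beta> x) (\<beta> y)" for x y z
      by (simp_all add: vec_eq_iff forall_4 \<beta> \<gamma> algebra_simps)
  qed
  show thesis
  proof (rule that[OF auto])
    fix t D' assume "aff_conj \<beta> \<gamma> (t, D) = (\<gamma> t, D')"
    then have D': "D' z = \<gamma> (D (\<beta> z))" for z
      using aff_conj_apply(2)[OF auto, of "(t, D)" z] by simp
    have ax: "ee 1 $ 1 = 1" "ee 1 $ 2 = 0" "ee 1 $ 3 = 0" "ee 1 $ 4 = 0"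
      "ee 2 $ 1 = 0" "ee 2 $ 2 = 1" "ee 2 $ 3 = 0" "ee 2 $ 4 = 0"
      by (simp_all add: axis_def)
    note nth = derivation_n4_nth[OF D]
    have A: "cA D' = cA D" "cE D' = cE D"
      unfolding cA_def[of D'] cE_def[of D'] D' \<gamma> nth \<beta> ax by (simp_all add: algebra_simps)
    have K: "cK D' = k" and B: "cB D' = b"
      unfolding cK_def[of D'] cB_def[of D'] D' \<gamma> nth \<beta> ax k_def b_def by (simp_all add: algebra_simps)
    have L: "cL D' = (cL D + s * cK D - k * s) + cA D * u" and C: "cC D' = c"
      unfolding cL_def[of D'] cC_def[of D'] D' \<gamma> nth \<beta> ax k_def b_def c_def
      by (simp_all add: algebra_simps)
    have DD: "cD D' = (cD D + p * cL D + q * cK D - b * (u / 2) - c * s) + (cA D + cE D) * r"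
      unfolding cD_def[of D'] D' \<gamma> nth \<beta> ax k_def b_def c_def by (simp add: algebra_simps)
    show "cA D' = cA D \<and> cE D' = cE D \<and>
       cA D * cK D' = 0 \<and> cA D * cL D' = 0 \<and> (cE D - cA D) * cB D' = 0 \<and> cE D * cC D' = 0 \<and>
       (cA D + cE D) * cD D' = 0"
      unfolding A K B L C DD using s p u q r by (simp add: k_def b_def c_def)
  qed
qed

text \<open>The coordinate \<open>v $ j\<close> enters the \<open>j\<close>-th coordinate of
  \<open>aff_transl\<close> linearly, with coefficient minus the \<open>j\<close>-th weight, and
  leaves the earlier ones alone. So the coordinates are solved for in turn, with the sign absorbed
  into \<open>v\<close>.\<close>

lemma normalize_translation:
  assumes D: "derivation n4 D"
  obtains v where "cA D * aff_transl v (t, D) $ 1 = 0" "cE D * aff_transl v (t, D) $ 2 = 0"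
    "(cA D + cE D) * aff_transl v (t, D) $ 3 = 0" "(2 * cA D + cE D) * aff_transl v (t, D) $ 4 = 0"
proof -
  note nth = aff_transl_nth[OF D]
  obtain v1 where v1: "cA D * (t $ 1 + cA D * v1) = 0" using solve_linear_or_zero by blast
  obtain v2 where v2: "cE D * ((t $ 2 + cB D * v1) + cE D * v2) = 0" using solve_linear_or_zero by blast
  obtain v3 where v3: "(cA D + cE D) * (aff_transl (vector [- v1, - v2, 0, 0]) (t, D) $ 3 + (cA D + cE D) * v3) = 0"
    using solve_linear_or_zero by blast
  obtain v4 where v4: "(2 * cA D + cE D) * (aff_transl (vector [- v1, - v2, - v3, 0]) (t, D) $ 4 + (2 * cA D + cE D) * v4) = 0"
    using solve_linear_or_zero by blast
  let ?v = "vector [- v1, - v2, - v3, - v4] :: real^4"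
  have "aff_transl ?v (t, D) $ 1 = t $ 1 + cA D * v1"
    "aff_transl ?v (t, D) $ 2 = (t $ 2 + cB D * v1) + cE D * v2"
    "aff_transl ?v (t, D) $ 3 = aff_transl (vector [- v1, - v2, 0, 0]) (t, D) $ 3 + (cA D + cE D) * v3"
    "aff_transl ?v (t, D) $ 4 = aff_transl (vector [- v1, - v2, - v3, 0]) (t, D) $ 4 + (2 * cA D + cE D) * v4"
    unfolding nth vector_4 by (simp_all add: algebra_simps)
  with v1 v2 v3 v4 show thesis
    by (intro that[of ?v]) (simp_all only:)
qed

text \<open>After normalization the translation part \<open>T\<close> of \<open>\<phi>\<close> is an invertible matrix with
  \<open>(w\<^sub>j - \<kappa>\<^sub>i) T\<^sub>j\<^sub>i = 0\<close>, so a nonzero term of its determinant matches the weights with the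
  eigenvalues.\<close>

lemma diagonal_weights:
  assumes \<phi>: "aff_morphism b n4 \<phi>" and inj: "\<forall>y X. aff_velocity y (\<phi> X) = 0 \<longrightarrow> X = 0"
    and b: "\<And>i. b X (ee i) = \<kappa> i *\<^sub>R ee i"
  obtains a e p where "p permutes (UNIV :: 4 set)" "\<forall>i. (vector [a, e, a + e, 2 * a + e] :: real^4) $ i = \<kappa> (p i)"
proof -
  have der: "derivation n4 (snd (\<phi> X))" using \<phi> by (simp add: aff_morphism_def)
  obtain \<beta> \<gamma> where auto: "n4_auto \<beta> \<gamma>" and
    norm: "\<And>t D'. aff_conj \<beta> \<gamma> (t, snd (\<phi> X)) = (\<gamma> t, D') \<Longrightarrow> cA D' = cA (snd (\<phi> X)) \<and> cE D' = cE (snd (\<phi> X)) \<and>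
       cA (snd (\<phi> X)) * cK D' = 0 \<and> cA (snd (\<phi> X)) * cL D' = 0 \<and>
       (cE (snd (\<phi> X)) - cA (snd (\<phi> X))) * cB D' = 0 \<and> cE (snd (\<phi> X)) * cC D' = 0 \<and>
       (cA (snd (\<phi> X)) + cE (snd (\<phi> X))) * cD D' = 0"
    by (rule normalize_derivation[OF der]) blast
  define \<phi>1 where "\<phi>1 Z = aff_conj \<beta> \<gamma> (\<phi> Z)" for Z
  have \<phi>1: "aff_morphism b n4 \<phi>1"
    unfolding \<phi>1_def by (rule aff_morphism_aff_conj[OF \<phi> auto])
  define D where "D = snd (\<phi>1 X)"
  have derD: "derivation n4 D" using \<phi>1 by (simp add: aff_morphism_def D_def)
  have "aff_conj \<beta> \<gamma> (fst (\<phi> X), snd (\<phi> X)) = (\<gamma> (fst (\<phi> X)), D)"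
    by (simp add: D_def \<phi>1_def prod_eq_iff aff_conj_apply[OF auto])
  from norm[OF this] have N: "cA D * cK D = 0" "cA D * cL D = 0" "(cE D - cA D) * cB D = 0"
    "cE D * cC D = 0" "(cA D + cE D) * cD D = 0"
    by simp_all
  obtain v where T: "cA D * aff_transl v (fst (\<phi>1 X), D) $ 1 = 0" "cE D * aff_transl v (fst (\<phi>1 X), D) $ 2 = 0"
    "(cA D + cE D) * aff_transl v (fst (\<phi>1 X), D) $ 3 = 0"
    "(2 * cA D + cE D) * aff_transl v (fst (\<phi>1 X), D) $ 4 = 0"
    by (rule normalize_translation[OF derD])
  define \<psi> where "\<psi> Z = (aff_transl v (\<phi>1 Z), snd (\<phi>1 Z))" for Z
  have \<psi>: "aff_morphism b n4 \<psi>"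
    unfolding \<psi>_def by (rule aff_morphism_aff_transl[OF \<phi>1])
  have \<psi>X: "\<psi> X = (aff_transl v (fst (\<phi>1 X), D), D)" by (simp add: \<psi>_def D_def)
  have lin: "linear (\<lambda>Z. fst (\<psi> Z))"
    using \<psi> linear_compose[OF _ linear_fst, of \<psi>] by (simp add: aff_morphism_def comp_def)
  \<comment> \<open>A vanishing translation part after both conjugations is a zero of the original
    field at the point \<open>\<beta> (- v)\<close>.\<close>
  have inj': "Z = 0" if "fst (\<psi> Z) = 0" for Z
  proof (rule inj[rule_format])
    have "aff_velocity (- v) (\<phi>1 Z) = 0"
      using that by (intro aff_velocity_eq_0_if_aff_transl) (simp add: \<psi>_def)
    then have "\<gamma> (aff_velocity (\<beta> (- v)) (\<phi> Z)) = 0"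
      by (simp add: \<phi>1_def aff_velocity_aff_conj[OF auto])
    moreover have "linear \<beta>" "\<And>z. \<beta> (\<gamma> z) = z" using auto by (simp_all add: n4_auto_def)
    ultimately show "aff_velocity (\<beta> (- v)) (\<phi> Z) = 0" by (metis linear_0)
  qed
  let ?w = "vector [cA D, cE D, cA D + cE D, 2 * cA D + cE D] :: real^4"
  have w: "(?w $ j - \<kappa> i) * fst (\<psi> (ee i)) $ j = 0" for i j
  proof -
    have "\<forall>j. (?w $ j - \<kappa> i) * fst (\<psi> (ee i)) $ j = 0"
      unfolding forall_4 vector_4
      using eigenvector_weights[OF \<psi> \<psi>X _ b[of i] refl refl N T, of "fst (\<psi> (ee i))" "snd (\<psi> (ee i))"]
      by simp
    then show ?thesis ..
  qed
  let ?M = "matrix (\<lambda>Z. fst (\<psi> Z))"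
  have "inj (\<lambda>Z. fst (\<psi> Z))" using linear_injective_0[OF lin] inj' by blast
  then have "det ?M \<noteq> 0" using lin by (simp add: det_nz_iff_inj)
  then obtain p where p: "p permutes (UNIV :: 4 set)" "(\<Prod>j\<in>UNIV. ?M $ j $ p j) \<noteq> 0"
    unfolding det_def by (smt (verit, ccfv_SIG) mem_Collect_eq mult_eq_0_iff sum.neutral)
  show thesis
  proof (rule that[OF p(1)], rule allI)
    fix j
    have "?M $ j $ p j \<noteq> 0" using p(2) by (simp add: prod_zero_iff)
    then have "fst (\<psi> (ee (p j))) $ j \<noteq> 0" by (simp add: matrix_def)
    then show "?w $ j = \<kappa> (p j)" using w[of j "p j"] by simp
  qed
qed

section \<open>Comparison of the weights with the eigenvalues\<close>

text \<open>A product over all indices is invariant under the permutation. With polynomials,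
  evaluation at chosen points replaces a search through 24 permutations.\<close>

lemma diagonal_weights_poly:
  assumes "aff_morphism b n4 \<phi>" "\<forall>y X. aff_velocity y (\<phi> X) = 0 \<longrightarrow> X = 0"
    and b: "b X (ee 1) = \<kappa>\<^sub>1 *\<^sub>R ee 1" "b X (ee 2) = \<kappa>\<^sub>2 *\<^sub>R ee 2"
      "b X (ee 3) = \<kappa>\<^sub>3 *\<^sub>R ee 3" "b X (ee 4) = \<kappa>\<^sub>4 *\<^sub>R ee 4"
  obtains a e where "\<forall>x. (a - x) * (e - x) * (a + e - x) * (2 * a + e - x)
    = (\<kappa>\<^sub>1 - x) * (\<kappa>\<^sub>2 - x) * (\<kappa>\<^sub>3 - x) * (\<kappa>\<^sub>4 - x)"
proof -
  let ?\<kappa> = "vector [\<kappa>\<^sub>1, \<kappa>\<^sub>2, \<kappa>\<^sub>3, \<kappa>\<^sub>4] :: real^4"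
  have "\<forall>i. b X (ee i) = ?\<kappa> $ i *\<^sub>R ee i" by (simp add: forall_4 b)
  then have b': "b X (ee i) = ?\<kappa> $ i *\<^sub>R ee i" for i ..
  obtain a e p where p: "p permutes (UNIV :: 4 set)"
    and w: "\<forall>i. (vector [a, e, a + e, 2 * a + e] :: real^4) $ i = ?\<kappa> $ p i"
    by (rule diagonal_weights[OF assms(1,2), where X = X and \<kappa> = "($) ?\<kappa>", OF b']) (rule that)
  have "(\<Prod>i\<in>UNIV. (vector [a, e, a + e, 2 * a + e] :: real^4) $ i - x) = (\<Prod>i\<in>UNIV. ?\<kappa> $ i - x)" for x
    unfolding w[rule_format] by (rule prod.permute[OF p, unfolded comp_def, symmetric])
  moreover have "(\<Prod>i\<in>UNIV. f i) = f 1 * f 2 * f 3 * f 4" for f :: "4 \<Rightarrow> real"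
    unfolding UNIV_4 by (simp add: mult.assoc)
  ultimately show thesis by (intro that[of a e]) simp
qed

text \<open>The inverse isomorphism serves twice: it gives the linear coordinates on
  \<open>'g\<close> for the Sard argument, and it moves the action to the basis on which the bracket
  is explicit.\<close>

lemma transport_to_standard:
  fixes g :: "'g::euclidean_space \<Rightarrow> 'g \<Rightarrow> 'g" and b :: "real^4 \<Rightarrow> real^4 \<Rightarrow> real^4"
  assumes st: "simply_transitive_action g n4 \<phi>" and iso: "lie_isomorphic g b"
  obtains \<psi> where "aff_morphism b n4 \<psi>" "\<forall>y X. aff_velocity y (\<psi> X) = 0 \<longrightarrow> X = 0"
proof -
  obtain f where f: "linear f" "bij f" "\<And>x y. f (g x y) = b (f x) (f y)"
    using iso by (auto simp: lie_isomorphic_def lie_iso_def)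
  let ?L = "inv_into UNIV f"
  have L: "linear ?L" "bij ?L" using f by (simp_all add: inv_into_linear bij_imp_bij_inv)
  have inv: "f (?L x) = x" "?L (f z) = z" for x z
    using f(2) by (simp_all add: bij_is_surj surj_f_inv_f bij_is_inj)
  have "b x y = f (g (?L x) (?L y))" for x y by (simp add: f(3) inv)
  then have br: "?L (b x y) = g (?L x) (?L y)" for x y by (simp add: inv)
  have \<phi>: "aff_morphism g n4 \<phi>" using st by (simp add: simply_transitive_action_def)
  show thesis
  proof (rule that[of "\<lambda>x. \<phi> (?L x)"])
    show "aff_morphism b n4 (\<lambda>x. \<phi> (?L x))"
      using \<phi> linear_compose[OF L(1), of \<phi>] by (simp add: aff_morphism_def br comp_def)
    have "X = 0" if "aff_velocity y (\<phi> (?L X)) = 0" for y X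
    proof -
      have "?L X = 0" using that by (rule simply_transitive_aff_velocity_inj[OF st L])
      then show "X = 0" using inv(1)[of X] linear_0[OF f(1)] by simp
    qed
    then show "\<forall>y X. aff_velocity y (\<phi> (?L X)) = 0 \<longrightarrow> X = 0" by blast
  qed
qed

text \<open>The constant and the linear coefficient of the right side vanish, so two of the four
  forms are zero. Two of them determine \<open>a\<close> and \<open>e\<close>, hence all vanish and
  both sides equal \<open>x^4\<close>.\<close>

lemma weights_with_double_zero:
  fixes a e \<alpha> \<beta> :: real
  assumes h: "\<And>x. (a - x) * (e - x) * (a + e - x) * (2 * a + e - x) = x * x * (\<alpha> - x) * (\<beta> - x)"
  shows "\<alpha> = 0"
proof -
  have "a * e * (a + e) * (2 * a + e) = 0" using h[of 0] by simp
  \<comment> \<open>This is minus the coefficient of \<open>x\<close>. Differences of the values at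
    1, -1 and at 2, -2 separate it from the coefficient of \<open>x^3\<close>.\<close>
  moreover have "a * e * (a + e) + a * e * (2 * a + e) + a * (a + e) * (2 * a + e)
      + e * (a + e) * (2 * a + e) = 0"
    using h[of 1] h[of "-1"] h[of 2] h[of "-2"] by (simp add: algebra_simps)
  ultimately have z: "a = 0" "e = 0" by auto
  have "1 = (\<alpha> - 1) * (\<beta> - 1)" "1 = (\<alpha> + 1) * (\<beta> + 1)"
    using h[of 1] h[of "-1"] by (simp_all add: z algebra_simps)
  then have "\<alpha> + \<beta> = \<alpha> * \<beta>" "\<alpha> + (\<beta> + \<alpha> * \<beta>) = 0"
    by (simp_all add: algebra_simps)
  then have "\<alpha> + \<beta> = 0" "\<alpha> * \<beta> = 0" by linarith+
  then show ?thesis by auto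
qed

text \<open>Cancelling the zero weight leaves three factors on each side, and the root 1 limits the
  scale to a few values. The scalings outside the stated list give the nonzero eigenvalues {1, 1,
  2}, {1, 1, -1}, {1, -1, -2} or {-1, 1, 2}; these are multiples of admissible lists, and the bounds
  on \<mu> and \<nu> discard them.\<close>

lemma r4_weights:
  fixes a e \<mu> \<nu> :: real
  assumes h: "\<And>x. (a - x) * (e - x) * (a + e - x) * (2 * a + e - x) = (0 - x) * (1 - x) * (\<mu> - x) * (\<nu> - x)"
    and range: "\<mu> * \<nu> \<noteq> 0" "-1 < \<mu> \<and> \<mu> \<le> \<nu> \<and> \<nu> \<le> 1 \<or> -1 = \<mu> \<and> \<mu> \<le> \<nu> \<and> \<nu> < 0"
  shows "\<mu> = \<nu> \<and> \<nu> \<in> {-1, 1/2, 1} \<or> \<mu> = -1/2 \<and> \<nu> = 1/2"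
proof -
  have bounds: "-1 \<le> \<mu>" "\<mu> \<le> \<nu>" "\<nu> \<le> 1" "\<mu> = -1 \<Longrightarrow> \<nu> < 0" using range(2) by auto
  have "a * e * (a + e) * (2 * a + e) = 0" using h[of 0] by simp
  then consider "a = 0" | "e = 0" | "e = - a" | "e = - 2 * a" by (auto simp: add_eq_0_iff)
  then show ?thesis
  proof cases
    case 1
    have h': "(e - x) * (e - x) * (e - x) = (1 - x) * (\<mu> - x) * (\<nu> - x)" if "x \<noteq> 0" for x
      using h[of x] that by (simp add: 1)
    have "e = 1" using h'[of 1] by simp
    moreover have "e = \<mu>" "e = \<nu>" using h'[of \<mu>] h'[of \<nu>] range(1) by simp_all
    ultimately show ?thesis by simp
  next
    case 2
    have h': "(a - x) * (a - x) * (2 * a - x) = (1 - x) * (\<mu> - x) * (\<nu> - x)" if "x \<noteq> 0" for x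
      using h[of x] that by (simp add: 2)
    have "a = 1 \<or> a = 1/2" using h'[of 1] by auto
    then show ?thesis
    proof
      assume a: "a = 1"
      show ?thesis using h'[of 2] bounds by (simp add: a)
    next
      assume a: "a = 1/2"
      have "\<mu> = 1/2 \<or> \<nu> = 1/2" using h'[of "1/2"] by (simp add: a)
      then show ?thesis
      proof
        assume m: "\<mu> = 1/2"
        show ?thesis using h'[of 2] by (simp add: a m)
      next
        assume n: "\<nu> = 1/2"
        show ?thesis using h'[of 2] by (simp add: a n)
      qed
    qed
  next
    case 3
    have h': "(a - x) * (- a - x) * (a - x) = (1 - x) * (\<mu> - x) * (\<nu> - x)" if "x \<noteq> 0" for x
      using h[of x] that by (simp add: 3)
    have "a = 1 \<or> a = -1" using h'[of 1] by auto
    then show ?thesis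
    proof
      assume a: "a = 1"
      have "\<mu> = -1 \<or> \<nu> = -1" using h'[of "-1"] by (auto simp: a)
      then show ?thesis using h'[of 2] bounds by (auto simp: a)
    next
      assume a: "a = -1"
      have "\<mu> = -1 \<or> \<nu> = -1" using h'[of "-1"] by (auto simp: a)
      then show ?thesis using h'[of 2] bounds by (auto simp: a)
    qed
  next
    case 4
    have h': "(a - x) * (- 2 * a - x) * (- a - x) = (1 - x) * (\<mu> - x) * (\<nu> - x)" if "x \<noteq> 0" for x
      using h[of x] that by (simp add: 4)
    have "a = 1 \<or> a = -1/2 \<or> a = -1" using h'[of 1] by auto
    then show ?thesis
    proof (elim disjE)
      assume a: "a = 1"
      show ?thesis using h'[of "-2"] bounds by (simp add: a)
    next
      assume a: "a = -1/2"
      show ?thesis using h'[of "-1/2"] h'[of "1/2"] bounds by (auto simp: a)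
    next
      assume a: "a = -1"
      show ?thesis using h'[of 2] bounds by (simp add: a)
    qed
  qed
qed

theorem proposition6p2:
  fixes g :: "'g::euclidean_space \<Rightarrow> 'g \<Rightarrow> 'g"
  assumes "lie_algebra g"
    and "(\<exists>\<nu>. \<bar>\<nu>\<bar> \<le> 1 \<and> lie_isomorphic g (rr3 \<nu>)) \<or>
         (\<exists>\<nu>. \<nu> \<ge> 0 \<and> lie_isomorphic g (rr3' \<nu>)) \<or>
         lie_isomorphic g r2r2 \<or>
         lie_isomorphic g r2' \<or>
         (\<exists>\<mu> \<nu>. \<mu> * \<nu> \<noteq> 0 \<and> (-1 < \<mu> \<and> \<mu> \<le> \<nu> \<and> \<nu> \<le> 1 \<or> -1 = \<mu> \<and> \<mu> \<le> \<nu> \<and> \<nu> < 0) \<and>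
            lie_isomorphic g (r4 \<mu> \<nu>)) \<or>
         (\<exists>\<gamma> \<delta>. \<gamma> > 0 \<and> lie_isomorphic g (r4' \<gamma> \<delta>))"
  shows "(\<exists>\<phi>. simply_transitive_action g n4 \<phi>) \<longleftrightarrow>
         (\<exists>\<mu> \<nu>. (\<mu> = \<nu> \<and> \<nu> \<in> {-1, 1/2, 1} \<or> \<mu> = -1/2 \<and> \<nu> = 1/2) \<and>
            lie_isomorphic g (r4 \<mu> \<nu>))"
proof
  assume "\<exists>\<mu> \<nu>. (\<mu> = \<nu> \<and> \<nu> \<in> {-1, 1/2, 1} \<or> \<mu> = -1/2 \<and> \<nu> = 1/2) \<and> lie_isomorphic g (r4 \<mu> \<nu>)"
  then show "\<exists>\<phi>. simply_transitive_action g n4 \<phi>"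
    using r4_special_simply_transitive by blast
next
  assume "\<exists>\<phi>. simply_transitive_action g n4 \<phi>"
  then obtain \<phi> where st: "simply_transitive_action g n4 \<phi>" ..
  \<comment> \<open>Each algebra treated here has an element with eigenvalues
    \<open>0, 0, 1, \<beta>\<close>, for which \<open>weights_with_double_zero\<close> would yield
    \<open>1 = 0\<close>.\<close>
  have no_double_zero: False
    if iso: "lie_isomorphic g b" and b: "\<And>i. b (ee 1) (ee i) = \<kappa> $ i *\<^sub>R ee i"
      and \<kappa>: "\<And>x. (\<kappa> $ 1 - x) * (\<kappa> $ 2 - x) * (\<kappa> $ 3 - x) * (\<kappa> $ 4 - x) = x * x * (1 - x) * (\<beta> - x)"
    for b \<beta> and \<kappa> :: "real^4"
  proof -
    obtain \<psi> where \<psi>: "aff_morphism b n4 \<psi>" "\<forall>y X. aff_velocity y (\<psi> X) = 0 \<longrightarrow> X = 0"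
      by (rule transport_to_standard[OF st iso])
    obtain a e where h: "\<forall>x. (a - x) * (e - x) * (a + e - x) * (2 * a + e - x)
        = (\<kappa> $ 1 - x) * (\<kappa> $ 2 - x) * (\<kappa> $ 3 - x) * (\<kappa> $ 4 - x)"
      by (rule diagonal_weights_poly[OF \<psi> b[of 1] b[of 2] b[of 3] b[of 4]])
    from weights_with_double_zero[of a e 1 \<beta>, OF h[rule_format, unfolded \<kappa>]] show False by simp
  qed
  have no_complex: False
    if iso: "lie_isomorphic g b" and b: "b X (ee i) = \<nu> *\<^sub>R ee i - Y" "b X Y = ee i + \<nu> *\<^sub>R Y"
    for b X Y \<nu> and i :: 4
  proof -
    obtain \<psi> where \<psi>: "aff_morphism b n4 \<psi>" "\<forall>y X. aff_velocity y (\<psi> X) = 0 \<longrightarrow> X = 0"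
      by (rule transport_to_standard[OF st iso])
    have "fst (\<psi> (ee i)) = 0" using \<psi>(1) b by (rule complex_pair_translation_zero)
    \<comment> \<open>At the point \<open>0\<close> only the translation part contributes to the
      velocity.\<close>
    then have "aff_velocity 0 (\<psi> (ee i)) = 0"
      by (simp add: aff_velocity_def vec_eq_iff forall_4)
    then have "ee i = 0" by (rule \<psi>(2)[rule_format])
    then show False by (simp add: axis_eq_0_iff)
  qed
  from assms(2) show "\<exists>\<mu> \<nu>. (\<mu> = \<nu> \<and> \<nu> \<in> {-1, 1/2, 1} \<or> \<mu> = -1/2 \<and> \<nu> = 1/2) \<and> lie_isomorphic g (r4 \<mu> \<nu>)"
  proof (elim disjE exE conjE)
    fix \<nu> assume "lie_isomorphic g (rr3 \<nu>)"
    then have False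
    proof (rule no_double_zero[where \<beta> = "\<nu>"])
      have "\<forall>i. rr3 \<nu> (ee 1) (ee i) = (vector [0, 1, \<nu>, 0] :: real^4) $ i *\<^sub>R ee i"
        by (simp add: forall_4 rr3_def wedge_def axis_def vec_eq_iff)
      then show "rr3 \<nu> (ee 1) (ee i) = (vector [0, 1, \<nu>, 0] :: real^4) $ i *\<^sub>R ee i" for i ..
    qed simp
    then show ?thesis ..
  next
    fix \<nu> assume "lie_isomorphic g (rr3' \<nu>)"
    then have False
      by (rule no_complex[where i = 2 and X = "ee 1" and Y = "ee 3"])
        (simp_all add: rr3'_def wedge_def axis_def vec_eq_iff forall_4)
    then show ?thesis ..
  next
    assume "lie_isomorphic g r2r2"
    then have False
    proof (rule no_double_zero[where \<beta> = "0"])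
      have "\<forall>i. r2r2 (ee 1) (ee i) = (vector [0, 1, 0, 0] :: real^4) $ i *\<^sub>R ee i"
        by (simp add: forall_4 r2r2_def wedge_def axis_def vec_eq_iff)
      then show "r2r2 (ee 1) (ee i) = (vector [0, 1, 0, 0] :: real^4) $ i *\<^sub>R ee i" for i ..
    qed (simp add: algebra_simps)
    then show ?thesis ..
  next
    assume "lie_isomorphic g r2'"
    then have False
    proof (rule no_double_zero[where \<beta> = "1"])
      have "\<forall>i. r2' (ee 1) (ee i) = (vector [0, 0, 1, 1] :: real^4) $ i *\<^sub>R ee i"
        by (simp add: forall_4 r2'_def wedge_def axis_def vec_eq_iff)
      then show "r2' (ee 1) (ee i) = (vector [0, 0, 1, 1] :: real^4) $ i *\<^sub>R ee i" for i ..
    qed (simp add: algebra_simps)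
    then show ?thesis ..
  next
    fix \<gamma> \<delta> assume "lie_isomorphic g (r4' \<gamma> \<delta>)"
    then have False
      by (rule no_complex[where i = 3 and X = "ee 1" and Y = "ee 4"])
        (simp_all add: r4'_def wedge_def axis_def vec_eq_iff forall_4)
    then show ?thesis ..
  next
    have r4: ?thesis if iso: "lie_isomorphic g (r4 \<mu> \<nu>)" and range: "\<mu> * \<nu> \<noteq> 0"
      "-1 < \<mu> \<and> \<mu> \<le> \<nu> \<and> \<nu> \<le> 1 \<or> -1 = \<mu> \<and> \<mu> \<le> \<nu> \<and> \<nu> < 0" for \<mu> \<nu>
    proof -
      obtain \<psi> where \<psi>: "aff_morphism (r4 \<mu> \<nu>) n4 \<psi>" "\<forall>y X. aff_velocity y (\<psi> X) = 0 \<longrightarrow> X = 0"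
        by (rule transport_to_standard[OF st iso])
      have "r4 \<mu> \<nu> (ee 1) (ee 1) = 0 *\<^sub>R ee 1" "r4 \<mu> \<nu> (ee 1) (ee 2) = 1 *\<^sub>R ee 2"
        "r4 \<mu> \<nu> (ee 1) (ee 3) = \<mu> *\<^sub>R ee 3" "r4 \<mu> \<nu> (ee 1) (ee 4) = \<nu> *\<^sub>R ee 4"
        by (simp_all add: r4_def wedge_def axis_def vec_eq_iff forall_4)
      from diagonal_weights_poly[OF \<psi> this] obtain a e where
        "\<forall>x. (a - x) * (e - x) * (a + e - x) * (2 * a + e - x) = (0 - x) * (1 - x) * (\<mu> - x) * (\<nu> - x)" .
      from r4_weights[OF this[rule_format] range] iso show ?thesis by blast
    qed
    {
      fix \<mu> \<nu> assume "\<mu> * \<nu> \<noteq> 0" "lie_isomorphic g (r4 \<mu> \<nu>)" "-1 < \<mu>" "\<mu> \<le> \<nu>" "\<nu> \<le> 1"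
      then show ?thesis by (intro r4[of \<mu> \<nu>]) auto
    next
      fix \<mu> \<nu> assume "\<mu> * \<nu> \<noteq> 0" "lie_isomorphic g (r4 \<mu> \<nu>)" "-1 = \<mu>" "\<mu> \<le> \<nu>" "\<nu> < 0"
      then show ?thesis by (intro r4[of \<mu> \<nu>]) auto
    }
  qed
qed

end
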